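(* Let $\beta=(\beta_j)_{j\ge0}$ be a sequence of non-negative real numbers, with generating series $\beta(t)=\sum_{j\ge0}\beta_jt^j$ and derived series $\beta'(t)=\sum_{j\ge1}j\beta_jt^{j-1}$. Set $$z^*=\inf\{t\in[0,1):\beta'(t)+\log(1-t)<0\}\wedge1,$$ and let $\zeta$ be the set of zeros of $\beta'(t)+\log(1-t)$ in $[0,z^* )$. Assume that $z^*<1$ and $\zeta=\emptyset$. For $N\in\mathbb{N}$, let $V^N$ be a set of $N$ vertices and let $\Lambda^N$ be a Poisson$(\beta)$ hypergraph on $V^N$. Denote by $V^{N*}$ the set of identifiable vertices of $\Lambda^N$ and by $\Lambda^{N*}$ the identifiable hypergraph of $\Lambda^N$. Then, as $N\to\infty$, the following limits hold in probability: $$|V^{N*}|/N\to z^*,\qquad |\Lambda^{N*}|/N\to\beta(z^* )-(1-z^* )\log(1-z^* ).$$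
   Context: A hypergraph on a finite set $V$ is a map $\Lambda:\mathcal{P}(V)\to\mathbb{Z}^+=\{0,1,2,\dots\}$ on the power set of $V$; $\Lambda(A)$ is the number of hyperedges over $A$, and $|\Lambda|=\sum_{A\subseteq V}\Lambda(A)$ is the total number of hyperedges. Identifiability: a vertex $v$ is identifiable in $1$ step if $\Lambda(\{v\})\ge1$; for $n\ge2$, it is identifiable in $n$ steps if it belongs to some $A\subseteq V$ with $\Lambda(A)\ge1$ all of whose other elements are identifiable in fewer than $n$ steps. A vertex is identifiable if it is identifiable in $n$ steps for some $n\ge1$. Let $V^*$ be the set of identifiable vertices. The identifiable hypergraph is $\Lambda^*(A)=\Lambda(A)1_{A\subseteq V^*}$ (so $|\Lambda^*|$ counts all hyperedges, including those over $\emptyset$, contained in $V^*$). A random hypergraph $\Lambda$ on a set $V$ with $|V|=N$ is Poisson$(\beta)$ if: the random variables $\Lambda(A)$, $A\subseteq V$, are independent; the distribution of $\Lambda(A)$ depends only on $|A|$; and $\sum_{|A|=j}\Lambda(A)\sim$ Poisson$(N\beta_j)$ for $j=0,1,\dots,N$. Equivalently, the $\Lambda(A)$ are independent Poisson variables with mean $N\beta_j/\binom{N}{j}$ when $|A|=j$. The series $\beta(t)$ and $\beta'(t)$ take values in $[0,\infty]$ for $t\ge0$ (value $+\infty$ where the series diverges). $a\wedge b=\min(a,b)$, and $\inf\emptyset=\infty$. *)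

theory Defs
  imports "HOL-Probability.Probability"
begin

section \<open>Hypergraphs and identifiability\<close>

text \<open>A hypergraph on a finite vertex set \<open>V\<close> is a function \<open>L :: 'v set \<Rightarrow> nat\<close>, of which only
  the values on subsets of \<open>V\<close> matter: \<open>L A\<close> is the number of hyperedges over \<open>A\<close>.\<close>

definition num_hyperedges :: "'v set \<Rightarrow> ('v set \<Rightarrow> nat) \<Rightarrow> nat" where
  "num_hyperedges V L = (\<Sum>A\<in>Pow V. L A)"

text \<open>The recursion decreases \<open>n\<close>, so the inductive predicate coincides with the recursive
  definition; no vertex is identifiable in \<open>0\<close> steps.\<close>

inductive identifiable_in :: "'v set \<Rightarrow> ('v set \<Rightarrow> nat) \<Rightarrow> nat \<Rightarrow> 'v \<Rightarrow> bool"
  for V :: "'v set" and L :: "'v set \<Rightarrow> nat" where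
  one_step: "v \<in> V \<Longrightarrow> L {v} \<ge> 1 \<Longrightarrow> identifiable_in V L 1 v"
| more_steps: "n \<ge> 2 \<Longrightarrow> A \<subseteq> V \<Longrightarrow> v \<in> A \<Longrightarrow> L A \<ge> 1 \<Longrightarrow>
    (\<And>w. w \<in> A - {v} \<Longrightarrow> \<exists>m<n. identifiable_in V L m w) \<Longrightarrow> identifiable_in V L n v"

definition identifiable_vertices :: "'v set \<Rightarrow> ('v set \<Rightarrow> nat) \<Rightarrow> 'v set" where
  "identifiable_vertices V L = {v \<in> V. \<exists>n\<ge>1. identifiable_in V L n v}"

definition identifiable_hypergraph :: "'v set \<Rightarrow> ('v set \<Rightarrow> nat) \<Rightarrow> 'v set \<Rightarrow> nat" where
  "identifiable_hypergraph V L = (\<lambda>A. if A \<subseteq> identifiable_vertices V L then L A else 0)"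

section \<open>Poisson hypergraphs\<close>

text \<open>\<^const>\<open>poisson_pmf\<close> is specified only for positive rates; Poisson(0) is the point mass at 0.\<close>

definition poisson0_pmf :: "real \<Rightarrow> nat pmf" where
  "poisson0_pmf r = (if r = 0 then return_pmf 0 else poisson_pmf r)"

definition poisson_hypergraph ::
  "'a measure \<Rightarrow> 'v set \<Rightarrow> (nat \<Rightarrow> real) \<Rightarrow> ('a \<Rightarrow> 'v set \<Rightarrow> nat) \<Rightarrow> bool" where
  "poisson_hypergraph M V \<beta> \<Lambda> \<longleftrightarrow>
     prob_space M \<and> finite V \<and>
     prob_space.indep_vars M (\<lambda>_. count_space UNIV) (\<lambda>A \<omega>. \<Lambda> \<omega> A) (Pow V) \<and>
     (\<forall>A\<in>Pow V. \<forall>B\<in>Pow V. card A = card B \<longrightarrow>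
        distr M (count_space UNIV) (\<lambda>\<omega>. \<Lambda> \<omega> A) = distr M (count_space UNIV) (\<lambda>\<omega>. \<Lambda> \<omega> B)) \<and>
     (\<forall>j\<le>card V.
        distr M (count_space UNIV) (\<lambda>\<omega>. \<Sum>A | A \<subseteq> V \<and> card A = j. \<Lambda> \<omega> A) =
          measure_pmf (poisson0_pmf (real (card V) * \<beta> j)))"

section \<open>The generating series and the threshold\<close>

text \<open>For \<open>\<beta>, t \<ge> 0\<close> these sums of non-negative terms exist in \<open>[0, \<infinity>]\<close>.\<close>

definition gen_series :: "(nat \<Rightarrow> real) \<Rightarrow> real \<Rightarrow> ereal" where
  "gen_series \<beta> t = (\<Sum>j. ereal (\<beta> j * t ^ j))"

definition derived_series :: "(nat \<Rightarrow> real) \<Rightarrow> real \<Rightarrow> ereal" where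
  "derived_series \<beta> t = (\<Sum>j. ereal (real (Suc j) * \<beta> (Suc j) * t ^ j))"

text \<open>The infimum is taken in \<^typ>\<open>ereal\<close>, where the empty set has infimum \<open>\<infinity>\<close>; the minimum
  with \<open>1\<close> lies in \<open>[0, 1]\<close>, so the conversion back to \<^typ>\<open>real\<close> is exact.\<close>

definition z_star :: "(nat \<Rightarrow> real) \<Rightarrow> real" where
  "z_star \<beta> = real_of_ereal
     (min (Inf (ereal ` {t \<in> {0..<1}. derived_series \<beta> t + ereal (ln (1 - t)) < 0})) 1)"

definition zeta :: "(nat \<Rightarrow> real) \<Rightarrow> real set" where
  "zeta \<beta> = {t \<in> {0..<z_star \<beta>}. derived_series \<beta> t + ereal (ln (1 - t)) = 0}"

section \<open>Convergence in probability\<close>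

text \<open>The random variables may live on different probability spaces, as the limit is a constant.
  Measurability is included, since \<^const>\<open>measure\<close> vanishes on non-measurable sets.\<close>

definition converges_in_prob ::
  "(nat \<Rightarrow> 'a measure) \<Rightarrow> (nat \<Rightarrow> 'a \<Rightarrow> real) \<Rightarrow> real \<Rightarrow> bool" where
  "converges_in_prob M X c \<longleftrightarrow>
     (\<forall>\<^sub>F N in sequentially. X N \<in> borel_measurable (M N)) \<and>
     (\<forall>\<epsilon>>0. (\<lambda>N. measure (M N) {\<omega> \<in> space (M N). \<bar>X N \<omega> - c\<bar> > \<epsilon>}) \<longlonglongrightarrow> 0)"

text \<open>If \<open>\<beta> \<ge> 0\<close> and \<open>z_star \<beta> < 1\<close> then \<open>gen_series\<close> is finite at \<open>z_star\<close>, so that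
  \<^const>\<open>real_of_ereal\<close> may be applied to it without loss.\<close>

lemma z_star_props:
  assumes "z_star \<beta> < 1"
  obtains t where "0 \<le> z_star \<beta>" "z_star \<beta> \<le> t" "t < 1"
    "derived_series \<beta> t + ereal (ln (1 - t)) < 0"
proof -
  let ?S = "{t \<in> {0..<1}. derived_series \<beta> t + ereal (ln (1 - t)) < 0}"
  have ne: "?S \<noteq> {}"
  proof
    assume e: "?S = {}"
    show False using assms unfolding z_star_def e by (simp add: top_ereal_def min_def)
  qed
  then obtain t where t: "t \<in> ?S" by blast
  have lb: "0 \<le> Inf (ereal ` ?S)" by (rule Inf_greatest) auto
  have ub: "Inf (ereal ` ?S) \<le> ereal t" using t by (intro Inf_lower) auto
  have t1: "0 \<le> t" "t < 1" "derived_series \<beta> t + ereal (ln (1 - t)) < 0" using t by auto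
  have m: "min (Inf (ereal ` ?S)) 1 = Inf (ereal ` ?S)"
    using ub t1(2) by (simp add: min_def) (metis ereal_less(3) le_less_trans less_imp_le order_trans)
  have z: "z_star \<beta> = real_of_ereal (Inf (ereal ` ?S))"
    unfolding z_star_def m ..
  have "0 \<le> z_star \<beta>" unfolding z using lb by (rule real_of_ereal_pos)
  moreover have "z_star \<beta> \<le> t"
    unfolding z using lb ub by (cases "Inf (ereal ` ?S)") auto
  ultimately show thesis using that t1 by blast
qed

lemma gen_series_z_star_finite:
  assumes nn: "\<And>j. \<beta> j \<ge> 0" and "z_star \<beta> < 1"
  shows "0 \<le> gen_series \<beta> (z_star \<beta>)" "gen_series \<beta> (z_star \<beta>) < \<infinity>"
proof -
  define z where "z = z_star \<beta>"
  obtain t where t: "0 \<le> z" "z \<le> t" "t < 1" "derived_series \<beta> t + ereal (ln (1 - t)) < 0"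
    using z_star_props[OF assms(2)] unfolding z_def by metis
  have fin: "derived_series \<beta> t \<noteq> \<infinity>" using t(4) by auto
  have sm: "summable (\<lambda>j. real (Suc j) * \<beta> (Suc j) * t ^ j)"
    by (rule summable_ereal) (use fin nn t in \<open>auto simp: derived_series_def\<close>)
  have "summable (\<lambda>j. \<beta> (Suc j) * z ^ Suc j)"
  proof (rule summable_comparison_test'[OF sm])
    fix j :: nat
    have "z ^ Suc j \<le> t ^ Suc j" using t by (intro power_mono) auto
    also have "\<dots> \<le> t ^ j" using t by (intro power_decreasing) auto
    also have "\<dots> \<le> real (Suc j) * t ^ j"
      using mult_right_mono[of 1 "real (Suc j)" "t ^ j"] t by simp
    finally have "\<beta> (Suc j) * z ^ Suc j \<le> \<beta> (Suc j) * (real (Suc j) * t ^ j)"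
      by (rule mult_left_mono) (rule nn)
    moreover have "0 \<le> \<beta> (Suc j) * z ^ Suc j" using nn t by (intro mult_nonneg_nonneg) auto
    ultimately show "norm (\<beta> (Suc j) * z ^ Suc j) \<le> real (Suc j) * \<beta> (Suc j) * t ^ j"
      by (simp only: real_norm_def abs_of_nonneg) (simp only: mult_ac)
  qed
  then have s: "summable (\<lambda>j. \<beta> j * z ^ j)"
    by (rule iffD1[OF summable_Suc_iff[where f = "\<lambda>j. \<beta> j * z ^ j"]])
  have "(\<lambda>j. ereal (\<beta> j * z ^ j)) sums ereal (\<Sum>j. \<beta> j * z ^ j)"
    using s by (simp only: sums_ereal summable_sums)
  then have eq: "gen_series \<beta> z = ereal (\<Sum>j. \<beta> j * z ^ j)"
    unfolding gen_series_def by (rule sums_unique[symmetric])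
  have "0 \<le> (\<Sum>j. \<beta> j * z ^ j)" using s nn t by (intro suminf_nonneg) auto
  then show "0 \<le> gen_series \<beta> (z_star \<beta>)" "gen_series \<beta> (z_star \<beta>) < \<infinity>"
    using eq by (auto simp: z_def)
qed

end

theory Submission
  imports Defs
begin

text \<open>
  Why the theorem holds. Fix the vertex set \<open>V\<close>, put \<open>N = card V\<close>, and let the hyperedge counts be
  independent Poisson variables whose rates depend on the cardinality only. The identifiable set is
  the least set \<open>S\<close> such that no hyperedge has exactly one vertex outside \<open>S\<close>. Hence it equals \<open>S\<close> iff
  \<open>S\<close> is identifiable from the hyperedges inside \<open>S\<close> alone and no hyperedge has exactly one
  vertex outside \<open>S\<close>. These two events concern disjoint families of hyperedges. If \<open>f S\<close> is the
  probability of the first one and \<open>p k\<close> the probability that a fixed vertex outside a \<open>k\<close>-set is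
  not reached from it, then the identifiable set equals \<open>S\<close> with probability
  \<open>f S * p (card S) ^ card (V - S)\<close>.

  Since these probabilities add up to \<open>1\<close> over the subsets of \<open>V\<close>, for every finite \<open>V\<close>, the
  weights satisfy the identity of Abel type \<open>abel_identity\<close>. Evaluated at \<open>p k\<close> it compares the
  number of identifiable vertices with a binomial variable \<open>B\<^sub>k\<close> of size \<open>N\<close> and success
  probability \<open>1 - p k\<close>: the probability of having exactly \<open>k\<close> identifiable vertices is at most that
  of \<open>B\<^sub>k = k\<close>, and the probability of having fewer than \<open>k\<close> is at least that of \<open>B\<^sub>k < k\<close>
  (\<open>card_identifiable_eq_le\<close>, \<open>card_identifiable_less_ge\<close>). This is the static trace of an
  exploration of the hypergraph that processes one identified vertex at a time: after \<open>k\<close> steps the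
  vertices that have been reached are distributed like independent coins of bias \<open>1 - p k\<close>, and the
  exploration stops as soon as they are only \<open>k\<close> in number.

  For the Poisson(\<open>\<beta>\<close>) hypergraph, \<open>p k\<close> is close to \<open>exp (- \<beta>' (k / N))\<close>, uniformly in \<open>k / N\<close>
  below any number less than some \<open>t > z_star \<beta>\<close> with \<open>\<beta>' t < \<infinity>\<close>. Strictly below \<open>z_star \<beta>\<close> the
  assumption on the zeros gives \<open>1 - exp (- \<beta>' s) > s\<close>, so that having exactly \<open>k\<close> identifiable
  vertices is a large deviation of \<open>B\<^sub>k\<close> and has exponentially small probability. Arbitrarily
  close to the right of \<open>z_star \<beta>\<close> there are \<open>s\<close> with \<open>1 - exp (- \<beta>' s) < s\<close>, and for such an \<open>s\<close>
  a single large deviation estimate bounds the probability of \<open>s N\<close> or more identifiable vertices.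

  For the hyperedges, multiplying the Poisson weights by \<open>x\<close> to the power of the number of hyperedges
  inside \<open>S\<close> amounts to multiplying all rates by \<open>x\<close>. So, on the event of \<open>k\<close> identifiable vertices,
  the generating function of the number of identifiable hyperedges is bounded by that of a Poisson
  variable with mean \<open>exposed_rate\<close>, the expected number of hyperedges with at most one vertex outside
  a fixed \<open>k\<close>-set (\<open>edge_count_chernoff\<close>). When \<open>k / N\<close> tends to \<open>z = z_star \<beta>\<close>, this mean divided by
  \<open>N\<close> tends to \<open>\<beta> z + (1 - z) * \<beta>' z\<close>, and \<open>\<beta>' z = - ln (1 - z)\<close>.
\<close>

section \<open>The identifiable vertices as a closure\<close>

text \<open>The step numbers of the other vertices of \<open>A\<close> are finitely many, so one number exceeds them all.\<close>

lemma identifiable_closed: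
  assumes "finite V" "A \<subseteq> V" "v \<in> A" "L A \<ge> 1" "A - {v} \<subseteq> identifiable_vertices V L"
  shows "v \<in> identifiable_vertices V L"
proof -
  have fin: "finite (A - {v})" using assms(1,2) finite_subset by blast
  have "\<forall>w\<in>A - {v}. \<exists>n. identifiable_in V L n w"
    using assms(5) by (auto simp: identifiable_vertices_def)
  then obtain n where n: "\<And>w. w \<in> A - {v} \<Longrightarrow> identifiable_in V L (n w) w" by metis
  define m where "m = (\<Sum>w\<in>A - {v}. n w) + 2"
  have "n w < m" if "w \<in> A - {v}" for w
    using member_le_sum[of w "A - {v}" n] that fin by (simp add: m_def)
  then have "identifiable_in V L m v"
    using n assms by (intro identifiable_in.more_steps[of m A V v L]) (auto simp: m_def)
  then show ?thesis
    using assms(2,3) by (auto simp: identifiable_vertices_def m_def intro!: exI[of _ m])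
qed

text \<open>Together with \<open>identifiable_closed\<close> this describes the identifiable vertices as the least set that
is closed under the hyperedges.\<close>

lemma identifiable_least:
  assumes closed: "\<And>A v. A \<subseteq> V \<Longrightarrow> v \<in> A \<Longrightarrow> L A \<ge> 1 \<Longrightarrow> A - {v} \<subseteq> Y \<Longrightarrow> v \<in> Y"
  shows "identifiable_vertices V L \<subseteq> Y"
proof
  fix v assume "v \<in> identifiable_vertices V L"
  then obtain n where "identifiable_in V L n v" by (auto simp: identifiable_vertices_def)
  then show "v \<in> Y"
  proof induction
    case (one_step v)
    then show ?case using closed[of "{v}" v] by auto
  next
    case (more_steps n A v)
    then show ?case using closed[of A v] by blast
  qed
qed

lemma identifiable_subset: "identifiable_vertices V L \<subseteq> V"
  by (auto simp: identifiable_vertices_def)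

text \<open>The sets that leave \<open>S\<close> in exactly one vertex: a hyperedge over one of them would identify that
vertex as soon as all of \<open>S\<close> is identified.\<close>

definition boundary :: "'v set \<Rightarrow> 'v set \<Rightarrow> 'v set set" where
  "boundary V S = (\<lambda>(v, A). insert v A) ` ((V - S) \<times> Pow S)"

text \<open>The conditions on the right concern disjoint families of hyperedges, those over subsets of \<open>S\<close> and
those over \<open>boundary V S\<close>. Under a product law they are therefore independent.\<close>

lemma identifiable_eq_iff:
  assumes "finite V"
  shows "identifiable_vertices V L = S \<longleftrightarrow>
    S \<subseteq> V \<and> identifiable_vertices S L = S \<and> (\<forall>A\<in>boundary V S. L A = 0)"
proof
  assume S: "identifiable_vertices V L = S"
  then have SV: "S \<subseteq> V" using identifiable_subset[of V L] by simp
  then have finS: "finite S" using assms by (rule finite_subset)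
  have cl: "v \<in> S" if "A \<subseteq> V" "v \<in> A" "L A \<ge> 1" "A - {v} \<subseteq> S" for A v
    using identifiable_closed[OF assms, of A v L] that S by simp
  have "identifiable_vertices V L \<subseteq> identifiable_vertices S L"
  proof (rule identifiable_least)
    fix A v
    assume A: "A \<subseteq> V" "v \<in> A" "L A \<ge> 1" "A - {v} \<subseteq> identifiable_vertices S L"
    then have AS: "A - {v} \<subseteq> S" using identifiable_subset[of S L] by (meson subset_trans)
    with cl A have "v \<in> S" by simp
    with AS have "A \<subseteq> S" by auto
    then show "v \<in> identifiable_vertices S L"
      using identifiable_closed[OF finS] A by simp
  qed
  then have "identifiable_vertices S L = S" using S identifiable_subset[of S L] by simp
  moreover have "L A = 0" if AB: "A \<in> boundary V S" for A
  proof (rule ccontr)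
    assume "L A \<noteq> 0"
    moreover obtain v B where "v \<in> V - S" "B \<subseteq> S" "A = insert v B"
      using AB by (auto simp: boundary_def)
    ultimately show False using cl[of A v] SV by auto
  qed
  ultimately show "S \<subseteq> V \<and> identifiable_vertices S L = S \<and> (\<forall>A\<in>boundary V S. L A = 0)"
    using SV by blast
next
  assume *: "S \<subseteq> V \<and> identifiable_vertices S L = S \<and> (\<forall>A\<in>boundary V S. L A = 0)"
  have "identifiable_vertices V L \<subseteq> S"
  proof (rule identifiable_least)
    fix A v
    assume A: "A \<subseteq> V" "v \<in> A" "L A \<ge> 1" "A - {v} \<subseteq> S"
    show "v \<in> S"
    proof (rule ccontr)
      assume "v \<notin> S"
      then have "A \<in> boundary V S"
        unfolding boundary_def using A by (intro image_eqI[of _ _ "(v, A - {v})"]) auto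
      then show False using * A by auto
    qed
  qed
  moreover have "identifiable_vertices S L \<subseteq> identifiable_vertices V L"
  proof (rule identifiable_least)
    fix A v
    assume "A \<subseteq> S" "v \<in> A" "L A \<ge> 1" "A - {v} \<subseteq> identifiable_vertices V L"
    moreover from this * have "A \<subseteq> V" by (meson subset_trans)
    ultimately show "v \<in> identifiable_vertices V L"
      using identifiable_closed[OF assms, of A v L] by simp
  qed
  ultimately show "identifiable_vertices V L = S" using * by simp
qed

lemma identifiable_cong:
  assumes "\<And>A. A \<subseteq> V \<Longrightarrow> L A = L' A"
  shows "identifiable_vertices V L = identifiable_vertices V L'"
proof -
  have "identifiable_in V L n v \<Longrightarrow> identifiable_in V L' n v"
    if eq: "\<And>A. A \<subseteq> V \<Longrightarrow> L A = L' A" for L L' n v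
  proof (induction rule: identifiable_in.induct)
    case (one_step v)
    then show ?case using eq[of "{v}"] identifiable_in.one_step[of v V L'] by simp
  next
    case (more_steps n A v)
    then show ?case
      using eq[of A] by (intro identifiable_in.more_steps[of n A V v L']) auto
  qed
  from this[of L L'] this[of L' L] show ?thesis
    using assms by (auto simp: identifiable_vertices_def)
qed

lemma num_identifiable_hyperedges:
  assumes "finite V"
  shows "num_hyperedges V (identifiable_hypergraph V L) = (\<Sum>A\<in>Pow (identifiable_vertices V L). L A)"
proof -
  have "(\<Sum>A\<in>Pow V. if A \<subseteq> identifiable_vertices V L then L A else 0) =
      (\<Sum>A\<in>Pow (identifiable_vertices V L). L A)"
    using assms identifiable_subset[of V L] by (intro sum.mono_neutral_cong_right) auto
  then show ?thesis by (simp add: num_hyperedges_def identifiable_hypergraph_def)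
qed

lemma sum_boundary:
  fixes g :: "nat \<Rightarrow> real"
  assumes "finite V" "S \<subseteq> V"
  shows "(\<Sum>A\<in>boundary V S. g (card A)) = real (card (V - S)) * (\<Sum>A\<in>Pow S. g (Suc (card A)))"
proof -
  have inj: "inj_on (\<lambda>(v, A). insert v A) ((V - S) \<times> Pow S)"
  proof (rule inj_onI, clarify)
    fix v w A B
    assume *: "v \<notin> S" "w \<notin> S" "A \<subseteq> S" "B \<subseteq> S" "insert v A = insert w B"
    then have "v = w" by (metis insert_iff subset_iff)
    with * show "v = w \<and> A = B" by (metis insert_ident subset_iff)
  qed
  have "(\<Sum>A\<in>boundary V S. g (card A)) = (\<Sum>(v, A)\<in>(V - S) \<times> Pow S. g (card (insert v A)))"
    unfolding boundary_def by (subst sum.reindex[OF inj]) (simp add: case_prod_unfold)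
  also have "\<dots> = (\<Sum>(v, A)\<in>(V - S) \<times> Pow S. g (Suc (card A)))"
  proof (intro sum.cong refl, clarify)
    fix v A assume "v \<notin> S" "A \<subseteq> S"
    then show "g (card (insert v A)) = g (Suc (card A))"
      using assms by (subst card_insert_disjoint) (auto intro: finite_subset)
  qed
  also have "\<dots> = real (card (V - S)) * (\<Sum>A\<in>Pow S. g (Suc (card A)))"
    by (simp add: sum.cartesian_product[symmetric])
  finally show ?thesis .
qed

lemma sum_Pow_card:
  fixes g :: "nat \<Rightarrow> real"
  assumes "finite S"
  shows "(\<Sum>A\<in>Pow S. g (card A)) = (\<Sum>j\<le>card S. real (card S choose j) * g j)"
proof -
  have "(\<Sum>A\<in>Pow S. g (card A)) = (\<Sum>j\<le>card S. \<Sum>A\<in>{A\<in>Pow S. card A = j}. g (card A))"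
    using assms by (intro sum.group[symmetric]) (auto intro: card_mono)
  also have "\<dots> = (\<Sum>j\<le>card S. real (card S choose j) * g j)"
    using n_subsets[OF assms] by (intro sum.cong refl) simp
  finally show ?thesis .
qed

section \<open>An identity of Abel type for weights on finite sets\<close>

lemma sum_Pow_binomial:
  fixes a b :: real
  assumes "finite W"
  shows "(\<Sum>U\<in>Pow W. a ^ card U * b ^ card (W - U)) = (a + b) ^ card W"
  using prod_add[OF assms, of "\<lambda>_. a" "\<lambda>_. b"] by simp

lemma sum_Pow_pairs_swap:
  fixes g :: "'v set \<Rightarrow> 'v set \<Rightarrow> real"
  assumes "finite S"
  shows "(\<Sum>T\<in>Pow S. \<Sum>U\<in>Pow (S - T). g T U) = (\<Sum>U\<in>Pow S. \<Sum>T\<in>Pow (S - U). g T U)"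
  using assms
  by (subst (1 2) sum.Sigma, simp, simp, simp, simp)
     (rule sum.reindex_bij_witness[of _ "\<lambda>(a, b). (b, a)" "\<lambda>(a, b). (b, a)"]; auto)

text \<open>Expanding \<open>(p (card T) - x) ^ card (S - T)\<close> over the subsets \<open>U\<close> of \<open>S - T\<close> and exchanging the sums
leaves, for each \<open>U\<close>, the hypothesis for the set \<open>S - U\<close>. The identity has a probabilistic reading
when \<open>p\<close> is a decreasing sequence of probabilities and \<open>x = p k\<close> with \<open>k \<ge> card S\<close>: give the elements of
\<open>S\<close> independent random times that exceed \<open>j\<close> with probability \<open>p j\<close>, and decompose the event that
all times are at most \<open>k\<close> according to the first \<open>j\<close> such that exactly \<open>j\<close> elements have a time of
at most \<open>j\<close>.\<close>

lemma abel_identity: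
  fixes f :: "'v set \<Rightarrow> real" and p :: "nat \<Rightarrow> real"
  assumes rec: "\<And>V. finite V \<Longrightarrow> (\<Sum>T\<in>Pow V. f T * p (card T) ^ card (V - T)) = 1"
    and fin: "finite S"
  shows "(\<Sum>T\<in>Pow S. f T * (p (card T) - x) ^ card (S - T)) = (1 - x) ^ card S"
proof -
  have "(\<Sum>T\<in>Pow S. f T * (p (card T) - x) ^ card (S - T)) =
      (\<Sum>T\<in>Pow S. \<Sum>U\<in>Pow (S - T). (- x) ^ card U * (f T * p (card T) ^ card (S - T - U)))"
  proof (intro sum.cong refl)
    fix T assume "T \<in> Pow S"
    then have "(p (card T) - x) ^ card (S - T) =
        (\<Sum>U\<in>Pow (S - T). (- x) ^ card U * p (card T) ^ card (S - T - U))"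
      using fin by (subst sum_Pow_binomial) auto
    then show "f T * (p (card T) - x) ^ card (S - T) =
        (\<Sum>U\<in>Pow (S - T). (- x) ^ card U * (f T * p (card T) ^ card (S - T - U)))"
      by (simp add: sum_distrib_left mult_ac)
  qed
  also have "\<dots> = (\<Sum>U\<in>Pow S. \<Sum>T\<in>Pow (S - U).
      (- x) ^ card U * (f T * p (card T) ^ card (S - T - U)))"
    by (rule sum_Pow_pairs_swap[OF fin])
  also have "\<dots> = (\<Sum>U\<in>Pow S. (- x) ^ card U *
      (\<Sum>T\<in>Pow (S - U). f T * p (card T) ^ card (S - U - T)))"
    unfolding sum_distrib_left by (intro sum.cong refl) (simp add: Diff_Diff_Int Diff_eq Int_ac)
  also have "\<dots> = (\<Sum>U\<in>Pow S. (- x) ^ card U * 1 ^ card (S - U))"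
    using fin by (simp add: rec)
  also have "\<dots> = (1 - x) ^ card S"
    using sum_Pow_binomial[OF fin, of "- x" 1] by simp
  finally show ?thesis .
qed

text \<open>For \<open>x = p (card S)\<close> all terms of \<open>abel_identity\<close> are non-negative, and \<open>f S\<close> is the one with
\<open>T = S\<close>.\<close>

lemma spanning_weight_le:
  fixes f :: "'v set \<Rightarrow> real" and p :: "nat \<Rightarrow> real"
  assumes rec: "\<And>V. finite V \<Longrightarrow> (\<Sum>T\<in>Pow V. f T * p (card T) ^ card (V - T)) = 1"
    and nonneg: "\<And>T. f T \<ge> 0" and anti: "antimono p" and fin: "finite S"
  shows "f S \<le> (1 - p (card S)) ^ card S"
proof -
  have "f S = f S * (p (card S) - p (card S)) ^ card (S - S)" by simp
  also have "\<dots> \<le> (\<Sum>T\<in>Pow S. f T * (p (card T) - p (card S)) ^ card (S - T))"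
    using fin nonneg anti
    by (intro member_le_sum mult_nonneg_nonneg zero_le_power) (auto simp: antimono_def card_mono)
  also have "\<dots> = (1 - p (card S)) ^ card S" by (rule abel_identity[OF rec fin])
  finally show ?thesis .
qed

text \<open>The powers \<open>(1 - p k) ^ card R\<close> are expanded by \<open>abel_identity\<close>. After exchanging the sums, for each
\<open>T\<close> the sets \<open>R\<close> between \<open>T\<close> and \<open>V\<close> with fewer than \<open>k\<close> elements contribute; dropping the bound on
\<open>R\<close> enlarges the sum and makes the binomial theorem applicable.\<close>

lemma small_closure_ge:
  fixes f :: "'v set \<Rightarrow> real" and p :: "nat \<Rightarrow> real"
  assumes rec: "\<And>V. finite V \<Longrightarrow> (\<Sum>T\<in>Pow V. f T * p (card T) ^ card (V - T)) = 1"
    and nonneg: "\<And>T. f T \<ge> 0" and anti: "antimono p" and p0: "\<And>n. p n \<ge> 0"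
    and fin: "finite V"
  shows "(\<Sum>R\<in>{R\<in>Pow V. card R < k}. (1 - p k) ^ card R * p k ^ card (V - R)) \<le>
    (\<Sum>T\<in>{T\<in>Pow V. card T < k}. f T * p (card T) ^ card (V - T))"
proof -
  let ?s = "\<lambda>T. card T < k"
  have diff_diff: "V - T - (R - T) = V - R" if "T \<subseteq> R" for R T :: "'v set"
    using that by auto
  have finV: "finite R" if "R \<in> Pow V" for R using that fin finite_subset by auto
  have "(\<Sum>R\<in>{R\<in>Pow V. ?s R}. (1 - p k) ^ card R * p k ^ card (V - R)) =
      (\<Sum>R\<in>{R\<in>Pow V. ?s R}. \<Sum>T\<in>Pow R. f T * (p (card T) - p k) ^ card (R - T) * p k ^ card (V - R))"
    by (intro sum.cong refl, subst abel_identity[OF rec, symmetric])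
       (auto simp: sum_distrib_right finV)
  also have "\<dots> = (\<Sum>(R, T)\<in>(SIGMA R:{R\<in>Pow V. ?s R}. Pow R).
      f T * (p (card T) - p k) ^ card (R - T) * p k ^ card (V - R))"
    using fin finV by (subst sum.Sigma) auto
  also have "\<dots> \<le> (\<Sum>(R, T)\<in>(SIGMA R:Pow V. {T\<in>Pow R. ?s T}).
      f T * (p (card T) - p k) ^ card (R - T) * p k ^ card (V - R))"
  proof (rule sum_mono2)
    show "finite (SIGMA R:Pow V. {T\<in>Pow R. ?s T})" using fin finV by auto
    show "(SIGMA R:{R\<in>Pow V. ?s R}. Pow R) \<subseteq> (SIGMA R:Pow V. {T\<in>Pow R. ?s T})"
    proof clarsimp
      fix R T assume "R \<subseteq> V" "card R < k" "T \<subseteq> R"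
      then show "card T < k" using card_mono[of R T] finV[of R] by auto
    qed
    fix RT assume "RT \<in> (SIGMA R:Pow V. {T\<in>Pow R. ?s T}) - (SIGMA R:{R\<in>Pow V. ?s R}. Pow R)"
    then obtain R T where "RT = (R, T)" "card T < k" by auto
    moreover have "p k \<le> p (card T)" using anti \<open>card T < k\<close> by (auto simp: antimono_def)
    ultimately show "0 \<le> (case RT of (R, T) \<Rightarrow>
        f T * (p (card T) - p k) ^ card (R - T) * p k ^ card (V - R))"
      using nonneg p0 by auto
  qed
  also have "\<dots> = (\<Sum>(T, W)\<in>(SIGMA T:{T\<in>Pow V. ?s T}. Pow (V - T)).
      f T * ((p (card T) - p k) ^ card W * p k ^ card (V - T - W)))"
    by (rule sum.reindex_bij_witness[of _ "\<lambda>(T, W). (T \<union> W, T)" "\<lambda>(R, T). (T, R - T)"])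
       (auto simp: diff_diff mult.assoc)
  also have "\<dots> = (\<Sum>T\<in>{T\<in>Pow V. ?s T}. f T * p (card T) ^ card (V - T))"
  proof -
    have "(\<Sum>W\<in>Pow (V - T). f T * ((p (card T) - p k) ^ card W * p k ^ card (V - T - W))) =
        f T * p (card T) ^ card (V - T)" for T
      using sum_Pow_binomial[of "V - T" "p (card T) - p k" "p k"] fin
      by (simp add: sum_distrib_left[symmetric])
    then show ?thesis using fin by (subst sum.Sigma[symmetric]) auto
  qed
  finally show ?thesis .
qed

section \<open>Factorising the law of the set of identifiable vertices\<close>

text \<open>In the degenerate case \<open>r = 0\<close> the formula is still right because \<open>0 ^ 0 = 1\<close>.\<close>

lemma pmf_poisson0:
  assumes "r \<ge> 0"
  shows "pmf (poisson0_pmf r) k = r ^ k / fact k * exp (- r)"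
  using assms by (cases "k = 0") (auto simp: poisson0_pmf_def)

lemma measure_pmf_prob_Int_set: "measure_pmf.prob p (A \<inter> set_pmf p) = measure_pmf.prob p A"
  by (rule measure_prob_cong_0) (auto simp: set_pmf_iff)

lemma measure_pair_pmf:
  "measure_pmf.prob (pair_pmf p q) (A \<times> B) = measure_pmf.prob p A * measure_pmf.prob q B"
proof -
  have "(A \<times> B) \<inter> set_pmf (pair_pmf p q) = (A \<inter> set_pmf p) \<times> (B \<inter> set_pmf q)" by auto
  then have "measure_pmf.prob (pair_pmf p q) (A \<times> B) =
      measure_pmf.prob (pair_pmf p q) ((A \<inter> set_pmf p) \<times> (B \<inter> set_pmf q))"
    by (metis measure_pmf_prob_Int_set)
  also have "\<dots> = measure_pmf.prob p (A \<inter> set_pmf p) * measure_pmf.prob q (B \<inter> set_pmf q)"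
    by (rule measure_pmf_prob_product) (auto intro: countable_subset[OF _ countable_set_pmf])
  finally show ?thesis by (simp only: measure_pmf_prob_Int_set)
qed

lemma measure_pmf_le_if_pmf_le:
  assumes le: "\<And>x. x \<in> E \<Longrightarrow> pmf p x \<le> K * pmf q x" and K: "K \<ge> 0"
  shows "measure_pmf.prob p E \<le> K * measure_pmf.prob q E"
proof -
  have "ennreal (measure_pmf.prob p E) = (\<integral>\<^sup>+x. ennreal (pmf p x) \<partial>count_space E)"
    by (simp add: nn_integral_pmf measure_pmf.emeasure_eq_measure)
  also have "\<dots> \<le> (\<integral>\<^sup>+x. ennreal K * ennreal (pmf q x) \<partial>count_space E)"
    using le K by (intro nn_integral_mono) (auto simp: ennreal_mult[symmetric] intro: ennreal_leI)
  also have "\<dots> = ennreal (K * measure_pmf.prob q E)"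
    using K by (simp add: nn_integral_cmult nn_integral_pmf measure_pmf.emeasure_eq_measure ennreal_mult)
  finally show ?thesis using K by (simp add: ennreal_le_iff)
qed

definition hypergraph_pmf :: "(nat \<Rightarrow> real) \<Rightarrow> 'v set \<Rightarrow> ('v set \<Rightarrow> nat) pmf" where
  "hypergraph_pmf r V = Pi_pmf (Pow V) 0 (\<lambda>A. poisson0_pmf (r (card A)))"

text \<open>The weight \<open>f\<close> of the previous section.\<close>

definition span_prob :: "(nat \<Rightarrow> real) \<Rightarrow> 'v set \<Rightarrow> real" where
  "span_prob r S = measure_pmf.prob (hypergraph_pmf r S) {L. identifiable_vertices S L = S}"

text \<open>The expected number of hyperedges over subsets of a fixed set with \<open>k\<close> elements.\<close>

definition inner_rate :: "(nat \<Rightarrow> real) \<Rightarrow> nat \<Rightarrow> real" where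
  "inner_rate r k = (\<Sum>j\<le>k. real (k choose j) * r j)"

text \<open>The expected number of hyperedges over those sets that consist of a fixed vertex and some elements
of a set with \<open>k\<close> elements not containing the vertex.\<close>

definition reach_rate :: "(nat \<Rightarrow> real) \<Rightarrow> nat \<Rightarrow> real" where
  "reach_rate r k = (\<Sum>j\<le>k. real (k choose j) * r (Suc j))"

lemma reach_rate_nonneg: "(\<And>j. r j \<ge> 0) \<Longrightarrow> reach_rate r k \<ge> 0"
  by (auto simp: reach_rate_def intro!: sum_nonneg)

lemma inner_rate_nonneg: "(\<And>j. r j \<ge> 0) \<Longrightarrow> inner_rate r k \<ge> 0"
  by (auto simp: inner_rate_def intro!: sum_nonneg)

lemma reach_rate_mono:
  assumes "\<And>j. r j \<ge> 0" "k \<le> l"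
  shows "reach_rate r k \<le> reach_rate r l"
proof -
  have "reach_rate r k \<le> (\<Sum>j\<le>k. real (l choose j) * r (Suc j))"
    unfolding reach_rate_def using assms
    by (intro sum_mono mult_right_mono) (auto intro: binomial_right_mono)
  also have "\<dots> \<le> reach_rate r l"
    unfolding reach_rate_def using assms by (intro sum_mono2) auto
  finally show ?thesis .
qed

lemma reach_rate_scale: "reach_rate (\<lambda>j. x * r j) k = x * reach_rate r k"
  by (simp add: reach_rate_def sum_distrib_left mult_ac)

lemma prob_no_boundary_edge:
  assumes "finite V" "S \<subseteq> V" and r: "\<And>j. r j \<ge> 0"
  shows "measure_pmf.prob (Pi_pmf (boundary V S) 0 (\<lambda>A. poisson0_pmf (r (card A))))
      {L. \<forall>A\<in>boundary V S. L A = 0} = exp (- reach_rate r (card S)) ^ card (V - S)"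
proof -
  have finS: "finite S" using assms finite_subset by blast
  have fin: "finite (boundary V S)" using assms finS by (simp add: boundary_def)
  have "{L. \<forall>A\<in>boundary V S. L A = (0::nat)} = Pi (boundary V S) (\<lambda>_. {0})" by auto
  then have "measure_pmf.prob (Pi_pmf (boundary V S) 0 (\<lambda>A. poisson0_pmf (r (card A))))
      {L. \<forall>A\<in>boundary V S. L A = 0} = (\<Prod>A\<in>boundary V S. exp (- r (card A)))"
    using fin r by (simp add: measure_Pi_pmf_Pi measure_pmf_single pmf_poisson0)
  also have "\<dots> = exp (- (\<Sum>A\<in>boundary V S. r (card A)))"
    using fin by (simp add: exp_sum sum_negf[symmetric])
  also have "(\<Sum>A\<in>boundary V S. r (card A)) = real (card (V - S)) * reach_rate r (card S)"
    using sum_boundary[OF assms(1,2), of r] sum_Pow_card[OF finS, of "\<lambda>j. r (Suc j)"]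
    by (simp add: reach_rate_def)
  also have "exp (- \<dots>) = exp (- reach_rate r (card S)) ^ card (V - S)"
    by (simp add: exp_of_nat_mult[symmetric])
  finally show ?thesis .
qed

text \<open>The condition \<open>Q\<close> on the number of hyperedges inside \<open>S\<close> is carried along because it depends on the
hyperedges inside \<open>S\<close> only; it is needed for the count of identifiable hyperedges.\<close>

lemma prob_identifiable_eq:
  assumes finV: "finite V" and S: "S \<subseteq> V" and r: "\<And>j. r j \<ge> 0"
  shows "measure_pmf.prob (hypergraph_pmf r V)
      {L. identifiable_vertices V L = S \<and> Q (\<Sum>A\<in>Pow S. L A)} =
    measure_pmf.prob (hypergraph_pmf r S)
      {L. identifiable_vertices S L = S \<and> Q (\<Sum>A\<in>Pow S. L A)} *
    exp (- reach_rate r (card S)) ^ card (V - S)"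
proof -
  let ?p = "\<lambda>A. poisson0_pmf (r (card A))" and ?B = "boundary V S"
  let ?U = "Pow S \<union> ?B"
  define E where "E = {L. identifiable_vertices S L = S \<and> Q (\<Sum>A\<in>Pow S. L A)}"
  define F where "F = {L :: 'a set \<Rightarrow> nat. \<forall>A\<in>?B. L A = 0}"
  have finS: "finite S" using assms finite_subset by blast
  have fin: "finite (Pow S)" "finite ?B" using assms finS by (auto simp: boundary_def)
  have disj: "Pow S \<inter> ?B = {}" by (auto simp: boundary_def)
  have sub: "?U \<subseteq> Pow V" using S by (auto simp: boundary_def)
  have E_cong: "L \<in> E \<longleftrightarrow> L' \<in> E" if "\<And>A. A \<subseteq> S \<Longrightarrow> L A = L' A" for L L'
  proof -
    have "(\<Sum>A\<in>Pow S. L A) = (\<Sum>A\<in>Pow S. L' A)" using that by (intro sum.cong) auto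
    then show ?thesis using identifiable_cong[of S L L'] that by (simp add: E_def)
  qed
  have "{L. identifiable_vertices V L = S \<and> Q (\<Sum>A\<in>Pow S. L A)} = E \<inter> F"
    using identifiable_eq_iff[OF finV, of _ S] S by (auto simp: E_def F_def)
  also have "\<dots> = (\<lambda>L A. if A \<in> ?U then L A else 0) -` (E \<inter> F)"
  proof -
    have "(\<lambda>A. if A \<in> ?U then L A else 0) \<in> E \<longleftrightarrow> L \<in> E" for L
      by (rule E_cong) auto
    then show ?thesis by (auto simp: F_def)
  qed
  finally have "measure_pmf.prob (hypergraph_pmf r V)
      {L. identifiable_vertices V L = S \<and> Q (\<Sum>A\<in>Pow S. L A)} =
      measure_pmf.prob (Pi_pmf ?U 0 ?p) (E \<inter> F)"
    using finV sub by (simp add: hypergraph_pmf_def Pi_pmf_subset[of "Pow V" ?U])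
  also have "\<dots> = measure_pmf.prob (pair_pmf (Pi_pmf (Pow S) 0 ?p) (Pi_pmf ?B 0 ?p))
      ((\<lambda>(f, g) A. if A \<in> Pow S then f A else g A) -` (E \<inter> F))"
    by (simp add: Pi_pmf_union[OF fin disj])
  also have "(\<lambda>(f, g) A. if A \<in> Pow S then f A else g A) -` (E \<inter> F) = E \<times> F"
  proof -
    have "(\<lambda>A. if A \<in> Pow S then f A else g A) \<in> E \<longleftrightarrow> f \<in> E" for f g :: "'a set \<Rightarrow> nat"
      by (rule E_cong) auto
    moreover have "(\<lambda>A. if A \<in> Pow S then f A else g A) \<in> F \<longleftrightarrow> g \<in> F" for f g :: "'a set \<Rightarrow> nat"
      using disj by (auto simp: F_def)
    ultimately show ?thesis by auto
  qed
  also have "measure_pmf.prob (pair_pmf (Pi_pmf (Pow S) 0 ?p) (Pi_pmf ?B 0 ?p)) (E \<times> F) =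
      measure_pmf.prob (hypergraph_pmf r S) E * exp (- reach_rate r (card S)) ^ card (V - S)"
    unfolding measure_pair_pmf F_def
    by (simp only: prob_no_boundary_edge[OF finV S, of r, OF r] hypergraph_pmf_def)
  finally show ?thesis by (simp add: E_def)
qed

lemma prob_identifiable_eq_span:
  assumes "finite V" "S \<subseteq> V" "\<And>j. r j \<ge> 0"
  shows "measure_pmf.prob (hypergraph_pmf r V) {L. identifiable_vertices V L = S} =
    span_prob r S * exp (- reach_rate r (card S)) ^ card (V - S)"
  using prob_identifiable_eq[where r = r, OF assms, where Q = "\<lambda>_. True"] by (simp add: span_prob_def)

lemma prob_sum_over_closure:
  assumes finV: "finite V"
  shows "measure_pmf.prob (hypergraph_pmf r V)
      {L. C (identifiable_vertices V L) \<and> P (identifiable_vertices V L) L} =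
    (\<Sum>S\<in>{S\<in>Pow V. C S}. measure_pmf.prob (hypergraph_pmf r V)
      {L. identifiable_vertices V L = S \<and> P S L})"
proof -
  have "{L. C (identifiable_vertices V L) \<and> P (identifiable_vertices V L) L} =
      (\<Union>S\<in>{S\<in>Pow V. C S}. {L. identifiable_vertices V L = S \<and> P S L})"
    using identifiable_subset[of V] by auto
  also have "measure_pmf.prob (hypergraph_pmf r V) \<dots> =
    (\<Sum>S\<in>{S\<in>Pow V. C S}. measure_pmf.prob (hypergraph_pmf r V)
      {L. identifiable_vertices V L = S \<and> P S L})"
    using finV by (intro measure_pmf.finite_measure_finite_Union) (auto simp: disjoint_family_on_def)
  finally show ?thesis .
qed

lemma span_prob_recursion:
  assumes "finite V" "\<And>j. r j \<ge> 0"
  shows "(\<Sum>S\<in>Pow V. span_prob r S * exp (- reach_rate r (card S)) ^ card (V - S)) = 1"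
proof -
  have "(\<Sum>S\<in>Pow V. span_prob r S * exp (- reach_rate r (card S)) ^ card (V - S)) =
      (\<Sum>S\<in>Pow V. measure_pmf.prob (hypergraph_pmf r V) {L. identifiable_vertices V L = S})"
    using assms by (intro sum.cong refl) (simp add: prob_identifiable_eq_span)
  also have "\<dots> = 1"
    using prob_sum_over_closure[OF assms(1), where r = r and C = "\<lambda>_. True" and P = "\<lambda>_ _. True"]
    by (simp add: Pow_def)
  finally show ?thesis .
qed

section \<open>The number of identifiable vertices and the binomial law\<close>

text \<open>The probability \<open>1 - p k\<close> that a vertex outside a set with \<open>k\<close> elements is reached from it.\<close>

definition reach_prob :: "(nat \<Rightarrow> real) \<Rightarrow> nat \<Rightarrow> real" where
  "reach_prob r k = 1 - exp (- reach_rate r k)"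

lemma reach_prob_bounds: "(\<And>j. r j \<ge> 0) \<Longrightarrow> reach_prob r k \<in> {0..1}"
  using reach_rate_nonneg[of r k] by (simp add: reach_prob_def)

lemma antimono_exp_reach: "(\<And>j. r j \<ge> 0) \<Longrightarrow> antimono (\<lambda>k. exp (- reach_rate r k))"
  by (auto simp: antimono_def intro: reach_rate_mono)

lemma span_prob_le:
  assumes "finite S" "\<And>j. r j \<ge> 0"
  shows "span_prob r S \<le> reach_prob r (card S) ^ card S"
  unfolding reach_prob_def using assms
  by (intro spanning_weight_le[where p = "\<lambda>k. exp (- reach_rate r k)"] span_prob_recursion antimono_exp_reach)
     (auto simp: span_prob_def)

text \<open>For a set with \<open>k\<close> elements, spanning has probability at most that of \<open>k\<close> successes, and avoiding
the boundary has exactly the probability of \<open>N - k\<close> failures.\<close>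

lemma card_identifiable_eq_le:
  assumes V: "finite V" and r: "\<And>j. r j \<ge> 0"
  shows "measure_pmf.prob (hypergraph_pmf r V) {L. card (identifiable_vertices V L) = k}
    \<le> pmf (binomial_pmf (card V) (reach_prob r k)) k"
proof -
  have "measure_pmf.prob (hypergraph_pmf r V) {L. card (identifiable_vertices V L) = k} =
      (\<Sum>S\<in>{S\<in>Pow V. card S = k}. measure_pmf.prob (hypergraph_pmf r V)
        {L. identifiable_vertices V L = S})"
    using prob_sum_over_closure[OF V, where r = r and C = "\<lambda>S. card S = k" and P = "\<lambda>_ _. True"]
    by simp
  also have "\<dots> \<le> (\<Sum>S\<in>{S\<in>Pow V. card S = k}. reach_prob r k ^ k * (1 - reach_prob r k) ^ (card V - k))"
  proof (rule sum_mono)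
    fix S assume "S \<in> {S\<in>Pow V. card S = k}"
    then have S: "S \<subseteq> V" "card S = k" "finite S" using V finite_subset by auto
    then have "card (V - S) = card V - k" using card_Diff_subset by blast
    then show "measure_pmf.prob (hypergraph_pmf r V) {L. identifiable_vertices V L = S} \<le>
        reach_prob r k ^ k * (1 - reach_prob r k) ^ (card V - k)"
      using S span_prob_le[where r = r, OF S(3) r] prob_identifiable_eq_span[where r = r, OF V S(1) r]
      by (simp add: reach_prob_def mult_right_mono)
  qed
  also have "\<dots> = pmf (binomial_pmf (card V) (reach_prob r k)) k"
    using n_subsets[OF V, of k] reach_prob_bounds[of r k, OF r] by simp
  finally show ?thesis .
qed

lemma card_identifiable_less_ge:
  assumes V: "finite V" and r: "\<And>j. r j \<ge> 0"
  shows "measure_pmf.prob (binomial_pmf (card V) (reach_prob r k)) {..<k} \<le>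
    measure_pmf.prob (hypergraph_pmf r V) {L. card (identifiable_vertices V L) < k}"
proof -
  let ?q = "reach_prob r k" and ?N = "card V"
  let ?g = "\<lambda>j. if j < k then ?q ^ j * (1 - ?q) ^ (?N - j) else 0"
  have "measure_pmf.prob (binomial_pmf ?N ?q) {..<k} = (\<Sum>j<k. pmf (binomial_pmf ?N ?q) j)"
    by (simp add: measure_measure_pmf_finite)
  also have "\<dots> = (\<Sum>j<k. real (?N choose j) * ?g j)"
    using reach_prob_bounds[of r k, OF r] by (intro sum.cong) auto
  also have "\<dots> = (\<Sum>j\<le>?N. real (?N choose j) * ?g j)"
  proof -
    have "(\<Sum>j<k. real (?N choose j) * ?g j) = (\<Sum>j\<in>{..<k} \<inter> {..?N}. real (?N choose j) * ?g j)"
      by (rule sum.mono_neutral_right) auto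
    also have "\<dots> = (\<Sum>j\<le>?N. real (?N choose j) * ?g j)"
      by (rule sum.mono_neutral_left) auto
    finally show ?thesis .
  qed
  also have "\<dots> = (\<Sum>R\<in>Pow V. ?g (card R))" by (rule sum_Pow_card[OF V, symmetric])
  also have "\<dots> = (\<Sum>R\<in>{R\<in>Pow V. card R < k}. ?q ^ card R * (1 - ?q) ^ card (V - R))"
    using V by (intro sum.mono_neutral_cong_right)
      (auto simp: card_Diff_subset finite_subset split: if_splits)
  also have "\<dots> = (\<Sum>R\<in>{R\<in>Pow V. card R < k}. (1 - exp (- reach_rate r k)) ^ card R *
      exp (- reach_rate r k) ^ card (V - R))"
    by (simp add: reach_prob_def)
  also have "\<dots> \<le> (\<Sum>S\<in>{S\<in>Pow V. card S < k}.
      span_prob r S * exp (- reach_rate r (card S)) ^ card (V - S))"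
    using V r
    by (intro small_closure_ge[where p = "\<lambda>k. exp (- reach_rate r k)"] span_prob_recursion antimono_exp_reach)
       (auto simp: span_prob_def)
  also have "\<dots> = (\<Sum>S\<in>{S\<in>Pow V. card S < k}. measure_pmf.prob (hypergraph_pmf r V)
        {L. identifiable_vertices V L = S})"
    using V r by (intro sum.cong refl) (auto simp: prob_identifiable_eq_span)
  also have "\<dots> = measure_pmf.prob (hypergraph_pmf r V) {L. card (identifiable_vertices V L) < k}"
    using prob_sum_over_closure[OF V, where r = r and C = "\<lambda>S. card S < k" and P = "\<lambda>_ _. True"]
    by simp
  finally show ?thesis .
qed

section \<open>Exponential tilting and the number of hyperedges\<close>

text \<open>A factor \<open>x\<close> per hyperedge turns a Poisson weight of rate \<open>r\<close> into one of rate \<open>x * r\<close>, up to the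
constant \<open>exp ((x - 1) * r)\<close>.\<close>

lemma pmf_hypergraph_tilt:
  fixes S :: "'v set"
  assumes S: "finite S" and r: "\<And>j. r j \<ge> 0" and x: "x \<ge> 0"
  shows "pmf (hypergraph_pmf r S) L * x ^ (\<Sum>A\<in>Pow S. L A) =
    exp ((x - 1) * inner_rate r (card S)) * pmf (hypergraph_pmf (\<lambda>j. x * r j) S) L"
proof (cases "\<forall>A. A \<notin> Pow S \<longrightarrow> L A = 0")
  case True
  have pmf_eq: "pmf (hypergraph_pmf r' S) L = (\<Prod>A\<in>Pow S. pmf (poisson0_pmf (r' (card A))) (L A))" for r'
    unfolding hypergraph_pmf_def using S True by (intro pmf_Pi') auto
  have "pmf (hypergraph_pmf r S) L * x ^ (\<Sum>A\<in>Pow S. L A) =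
      (\<Prod>A\<in>Pow S. pmf (poisson0_pmf (r (card A))) (L A) * x ^ L A)"
    by (simp add: pmf_eq power_sum prod.distrib)
  also have "\<dots> = (\<Prod>A\<in>Pow S. exp ((x - 1) * r (card A)) * pmf (poisson0_pmf (x * r (card A))) (L A))"
  proof (rule prod.cong[OF refl])
    fix A :: "'v set"
    have "exp ((x - 1) * r (card A)) * exp (- (x * r (card A))) = exp (- r (card A))"
      by (simp add: exp_add[symmetric] algebra_simps)
    then show "pmf (poisson0_pmf (r (card A))) (L A) * x ^ L A =
        exp ((x - 1) * r (card A)) * pmf (poisson0_pmf (x * r (card A))) (L A)"
      using r x by (simp add: pmf_poisson0 power_mult_distrib)
  qed
  also have "\<dots> = exp ((x - 1) * (\<Sum>A\<in>Pow S. r (card A))) *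
      (\<Prod>A\<in>Pow S. pmf (poisson0_pmf (x * r (card A))) (L A))"
    using S by (simp add: prod.distrib exp_sum sum_distrib_left)
  also have "(\<Sum>A\<in>Pow S. r (card A)) = inner_rate r (card S)"
    by (simp add: sum_Pow_card[OF S] inner_rate_def)
  finally show ?thesis by (simp add: pmf_eq)
next
  case False
  then show ?thesis using S by (auto simp: hypergraph_pmf_def pmf_Pi)
qed

text \<open>The expected number of hyperedges with at most one vertex outside a fixed set with \<open>k\<close> elements.\<close>

definition exposed_rate :: "(nat \<Rightarrow> real) \<Rightarrow> nat \<Rightarrow> nat \<Rightarrow> real" where
  "exposed_rate r N k = inner_rate r k + real (N - k) * reach_rate r k"

text \<open>A Chernoff bound in which \<open>x ^ n\<close> dominates the indicator of \<open>Q n\<close> up to the factor \<open>c\<close>. Tilting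
the hyperedges inside \<open>S\<close> contributes the exponent \<open>(x - 1) * inner_rate r k\<close>, and writing the
probability of an empty boundary with the rates \<open>x * r\<close> contributes the rest of \<open>exposed_rate\<close>. What
remains, summed over \<open>S\<close>, is at most a binomial probability for the rates \<open>x * r\<close>.\<close>

lemma edge_count_chernoff:
  assumes V: "finite V" and r: "\<And>j. r j \<ge> 0" and x: "x > 0" and c: "c > 0"
    and Q: "\<And>n. Q n \<Longrightarrow> x ^ n \<ge> c"
  shows "measure_pmf.prob (hypergraph_pmf r V) {L. card (identifiable_vertices V L) = k \<and>
      Q (\<Sum>A\<in>Pow (identifiable_vertices V L). L A)} \<le> exp ((x - 1) * exposed_rate r (card V) k) / c"
proof -
  let ?N = "card V" and ?xr = "\<lambda>j. x * r j"
  define q where "q = reach_prob ?xr k"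
  have xr: "\<And>j. ?xr j \<ge> 0" using r x by simp
  have q: "q \<in> {0..1}" unfolding q_def by (rule reach_prob_bounds[where r = ?xr, OF xr])
  define K where "K = exp ((x - 1) * exposed_rate r ?N k) / c"
  have K: "K \<ge> 0" using c by (simp add: K_def)
  have "measure_pmf.prob (hypergraph_pmf r V) {L. card (identifiable_vertices V L) = k \<and>
      Q (\<Sum>A\<in>Pow (identifiable_vertices V L). L A)} =
      (\<Sum>S\<in>{S\<in>Pow V. card S = k}. measure_pmf.prob (hypergraph_pmf r V)
        {L. identifiable_vertices V L = S \<and> Q (\<Sum>A\<in>Pow S. L A)})"
    by (rule prob_sum_over_closure[OF V])
  also have "\<dots> \<le> (\<Sum>S\<in>{S\<in>Pow V. card S = k}. K * (q ^ k * (1 - q) ^ (?N - k)))"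
  proof (rule sum_mono)
    fix S assume "S \<in> {S\<in>Pow V. card S = k}"
    then have S: "S \<subseteq> V" "card S = k" "finite S" using V finite_subset by auto
    then have cD: "card (V - S) = ?N - k" using card_Diff_subset by blast
    let ?E = "{L. identifiable_vertices S L = S \<and> Q (\<Sum>A\<in>Pow S. L A)}"
    let ?e = "exp ((x - 1) * inner_rate r k) / c"
    have "measure_pmf.prob (hypergraph_pmf r S) ?E \<le> ?e * measure_pmf.prob (hypergraph_pmf ?xr S) ?E"
    proof (rule measure_pmf_le_if_pmf_le)
      fix L assume "L \<in> ?E"
      then have "c \<le> x ^ (\<Sum>A\<in>Pow S. L A)" using Q by simp
      then have "pmf (hypergraph_pmf r S) L * c \<le> pmf (hypergraph_pmf r S) L * x ^ (\<Sum>A\<in>Pow S. L A)"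
        by (intro mult_left_mono) auto
      also have "\<dots> = exp ((x - 1) * inner_rate r k) * pmf (hypergraph_pmf ?xr S) L"
        using pmf_hypergraph_tilt[where r = r and x = x and L = L, OF S(3) r] x S by simp
      finally show "pmf (hypergraph_pmf r S) L \<le> ?e * pmf (hypergraph_pmf ?xr S) L"
        using c by (simp add: field_simps)
    qed (use c in simp)
    also have "\<dots> \<le> ?e * q ^ k"
    proof (rule mult_left_mono)
      have "measure_pmf.prob (hypergraph_pmf ?xr S) ?E \<le> span_prob ?xr S"
        unfolding span_prob_def by (rule measure_pmf.finite_measure_mono) auto
      also have "\<dots> \<le> q ^ k"
        using span_prob_le[where r = ?xr, OF S(3) xr] S by (simp add: q_def)
      finally show "measure_pmf.prob (hypergraph_pmf ?xr S) ?E \<le> q ^ k" .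
    qed (use c in simp)
    finally have *: "measure_pmf.prob (hypergraph_pmf r S) ?E \<le> ?e * q ^ k" .
    have "measure_pmf.prob (hypergraph_pmf r V) {L. identifiable_vertices V L = S \<and> Q (\<Sum>A\<in>Pow S. L A)}
        = measure_pmf.prob (hypergraph_pmf r S) ?E * exp (- reach_rate r k) ^ (?N - k)"
      using prob_identifiable_eq[where r = r, OF V S(1) r, of Q] S cD by simp
    also have "\<dots> \<le> ?e * q ^ k * exp (- reach_rate r k) ^ (?N - k)"
      using * by (intro mult_right_mono) auto
    also have "exp (- reach_rate r k) ^ (?N - k) =
        exp ((x - 1) * (real (?N - k) * reach_rate r k)) * (1 - q) ^ (?N - k)"
      by (simp add: q_def reach_prob_def reach_rate_scale exp_of_nat_mult[symmetric] exp_add[symmetric]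
        algebra_simps)
    also have "?e * q ^ k * (exp ((x - 1) * (real (?N - k) * reach_rate r k)) * (1 - q) ^ (?N - k)) =
        K * (q ^ k * (1 - q) ^ (?N - k))"
      by (simp add: K_def exposed_rate_def distrib_left exp_add)
    finally show "measure_pmf.prob (hypergraph_pmf r V)
        {L. identifiable_vertices V L = S \<and> Q (\<Sum>A\<in>Pow S. L A)} \<le> K * (q ^ k * (1 - q) ^ (?N - k))" .
  qed
  also have "\<dots> = K * pmf (binomial_pmf ?N q) k"
    using n_subsets[OF V, of k] q by simp
  also have "\<dots> \<le> K" using mult_left_mono[OF pmf_le_1 K] by simp
  finally show ?thesis by (simp add: K_def)
qed

lemma exp_le_quadratic:
  fixes y :: real
  assumes "\<bar>y\<bar> \<le> 1"
  shows "exp y \<le> 1 + y + y\<^sup>2"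
proof (cases "y \<ge> 0")
  case True
  then show ?thesis using exp_bound[of y] assms by simp
next
  case False
  have "1 - y \<le> exp (- y)" using exp_ge_add_one_self[of "- y"] by simp
  then have "exp y \<le> 1 / (1 - y)"
    using False by (simp add: exp_minus field_simps)
  also have "\<dots> \<le> 1 + y + y\<^sup>2"
  proof -
    have "(1 + y + y\<^sup>2) * (1 - y) = 1 - y * y\<^sup>2" by (simp add: power2_eq_square algebra_simps)
    moreover have "y * y\<^sup>2 \<le> 0" using False by (simp add: mult_le_0_iff)
    ultimately show ?thesis using False by (simp add: pos_divide_le_eq)
  qed
  finally show ?thesis .
qed

text \<open>The Chernoff bound for \<open>x = exp \<theta>\<close> and \<open>x = exp (- \<theta>)\<close>. The value of \<open>\<theta>\<close> makes the quadratic error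
\<open>\<theta>\<^sup>2 * (B + \<epsilon>)\<close> at most half of the linear gain \<open>\<theta> * \<epsilon> / 2\<close>.\<close>

lemma edge_count_concentration:
  assumes V: "finite V" and r: "\<And>j. r j \<ge> 0" and B: "B \<ge> 0" and e: "\<epsilon> > 0"
    and near: "\<bar>exposed_rate r (card V) k - real (card V) * B\<bar> \<le> real (card V) * \<epsilon> / 2"
  defines "\<theta> \<equiv> min 1 (\<epsilon> / (4 * (B + \<epsilon>)))"
  shows "measure_pmf.prob (hypergraph_pmf r V) {L. card (identifiable_vertices V L) = k \<and>
      \<bar>real (\<Sum>A\<in>Pow (identifiable_vertices V L). L A) - real (card V) * B\<bar> > real (card V) * \<epsilon>}
    \<le> 2 * exp (- (\<theta> * \<epsilon> / 4) * real (card V))"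
proof -
  let ?N = "real (card V)" and ?m = "exposed_rate r (card V) k"
  let ?X = "\<lambda>L. card (identifiable_vertices V L)"
  let ?Y = "\<lambda>L. \<Sum>A\<in>Pow (identifiable_vertices V L). L A"
  have \<theta>: "0 < \<theta>" "\<theta> \<le> 1" "\<theta> * (B + \<epsilon>) \<le> \<epsilon> / 4"
  proof -
    show "0 < \<theta>" "\<theta> \<le> 1" using B e by (auto simp: \<theta>_def)
    have "\<theta> * (B + \<epsilon>) \<le> \<epsilon> / (4 * (B + \<epsilon>)) * (B + \<epsilon>)"
      using B e by (intro mult_right_mono) (auto simp: \<theta>_def)
    also have "\<dots> = \<epsilon> / 4"
    proof -
      have "B + \<epsilon> \<noteq> 0" using B e by simp
      then show ?thesis by (metis nonzero_mult_divide_mult_cancel_right times_divide_eq_left)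
    qed
    finally show "\<theta> * (B + \<epsilon>) \<le> \<epsilon> / 4" .
  qed
  have m0: "?m \<ge> 0"
    using reach_rate_nonneg[of r k] inner_rate_nonneg[of r k] r by (simp add: exposed_rate_def)
  have near': "?m \<le> ?N * B + ?N * \<epsilon> / 2" "?N * B - ?N * \<epsilon> / 2 \<le> ?m" "?N * \<epsilon> \<ge> 0"
    using near e unfolding abs_le_iff by (linarith, linarith, simp)
  \<comment> \<open>Both tails at once: \<open>y\<close> is \<open>\<theta>\<close> or \<open>- \<theta>\<close>, and \<open>T\<close> is the threshold.\<close>
  have one_side: "measure_pmf.prob (hypergraph_pmf r V) {L. ?X L = k \<and> Q (?Y L)}
      \<le> exp (- (\<theta> * \<epsilon> / 4) * ?N)"
    if y: "\<bar>y\<bar> = \<theta>" and T: "y * (?m - T) \<le> - (\<theta> * ?N * \<epsilon> / 2)"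
      and Q: "\<And>n. Q n \<Longrightarrow> y * T \<le> y * real n" for y T Q
  proof -
    have "measure_pmf.prob (hypergraph_pmf r V) {L. ?X L = k \<and> Q (?Y L)}
        \<le> exp ((exp y - 1) * ?m) / exp (y * T)"
    proof (rule edge_count_chernoff[OF V r])
      fix n assume "Q n"
      then show "exp (y * T) \<le> exp y ^ n"
        using Q by (simp add: exp_of_nat_mult[symmetric] mult.commute)
    qed auto
    also have "\<dots> = exp ((exp y - 1) * ?m - y * T)" by (simp add: exp_diff)
    also have "(exp y - 1) * ?m - y * T \<le> - (\<theta> * \<epsilon> / 4) * ?N"
    proof -
      have "(exp y - 1) * ?m \<le> (y + y\<^sup>2) * ?m"
        using exp_le_quadratic[of y] y \<theta> m0 by (intro mult_right_mono) auto
      moreover have "y\<^sup>2 * ?m \<le> \<theta> * ?N * \<epsilon> / 4"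
      proof -
        have "y\<^sup>2 = \<theta> * \<theta>" using y by (metis power2_abs power2_eq_square)
        then have "y\<^sup>2 * ?m = \<theta> * (\<theta> * ?m)" by simp
        also have "\<dots> \<le> \<theta> * (\<theta> * (?N * (B + \<epsilon>)))"
          using near' \<theta> by (intro mult_left_mono) (auto simp: distrib_left)
        also have "\<dots> = \<theta> * (?N * (\<theta> * (B + \<epsilon>)))" by simp
        also have "\<dots> \<le> \<theta> * (?N * (\<epsilon> / 4))"
          using \<theta> by (intro mult_left_mono) auto
        finally show ?thesis by simp
      qed
      ultimately show ?thesis using T by (simp add: algebra_simps)
    qed
    finally show ?thesis by simp
  qed
  have up: "measure_pmf.prob (hypergraph_pmf r V) {L. ?X L = k \<and> ?N * (B + \<epsilon>) \<le> real (?Y L)}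
      \<le> exp (- (\<theta> * \<epsilon> / 4) * ?N)"
  proof (rule one_side[of \<theta> "?N * (B + \<epsilon>)"])
    have "?m - ?N * (B + \<epsilon>) \<le> - (?N * \<epsilon> / 2)" using near' unfolding distrib_left right_diff_distrib by linarith
    then show "\<theta> * (?m - ?N * (B + \<epsilon>)) \<le> - (\<theta> * ?N * \<epsilon> / 2)"
      using \<theta> mult_left_mono[of "?m - ?N * (B + \<epsilon>)" "- (?N * \<epsilon> / 2)" \<theta>] by (simp add: mult.assoc)
  qed (use \<theta> in auto)
  have down: "measure_pmf.prob (hypergraph_pmf r V) {L. ?X L = k \<and> real (?Y L) \<le> ?N * (B - \<epsilon>)}
      \<le> exp (- (\<theta> * \<epsilon> / 4) * ?N)"
  proof (rule one_side[of "- \<theta>" "?N * (B - \<epsilon>)"])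
    have "?N * (B - \<epsilon>) - ?m \<le> - (?N * \<epsilon> / 2)" using near' unfolding distrib_left right_diff_distrib by linarith
    then show "- \<theta> * (?m - ?N * (B - \<epsilon>)) \<le> - (\<theta> * ?N * \<epsilon> / 2)"
      using \<theta> mult_left_mono[of "?N * (B - \<epsilon>) - ?m" "- (?N * \<epsilon> / 2)" \<theta>] by (simp add: algebra_simps)
  qed (use \<theta> in auto)
  have "measure_pmf.prob (hypergraph_pmf r V) {L. ?X L = k \<and> \<bar>real (?Y L) - ?N * B\<bar> > ?N * \<epsilon>} \<le>
      measure_pmf.prob (hypergraph_pmf r V)
        ({L. ?X L = k \<and> ?N * (B + \<epsilon>) \<le> real (?Y L)} \<union> {L. ?X L = k \<and> real (?Y L) \<le> ?N * (B - \<epsilon>)})"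
    by (rule measure_pmf.finite_measure_mono) (auto simp: algebra_simps abs_if split: if_splits)
  also have "\<dots> \<le> exp (- (\<theta> * \<epsilon> / 4) * ?N) + exp (- (\<theta> * \<epsilon> / 4) * ?N)"
    using up down measure_Un_le[of
      "{L. ?X L = k \<and> ?N * (B + \<epsilon>) \<le> real (?Y L)}" "hypergraph_pmf r V"
      "{L. ?X L = k \<and> real (?Y L) \<le> ?N * (B - \<epsilon>)}"] by simp
  finally show ?thesis by simp
qed

section \<open>The law of a Poisson hypergraph\<close>

text \<open>Only positive arguments are available: generating functions will be compared through an \<open>n\<close>-th
root, which is unique for non-negative numbers.\<close>

lemma power_series_zero_imp:
  fixes d :: "nat \<Rightarrow> real"
  assumes zero: "\<And>s. 0 < s \<Longrightarrow> s < 1 \<Longrightarrow> (\<lambda>n. d n * s ^ n) sums 0"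
  shows "d n = 0"
proof (induction n rule: less_induct)
  case (less n)
  define F where "F s = (\<Sum>i. d (i + n) * s ^ i)" for s
  have shifted: "(\<lambda>i. d (i + n) * s ^ i) sums 0" if s: "0 < s" "s < 1" for s
  proof -
    have "(\<lambda>i. d (i + n) * s ^ (i + n)) sums 0"
      using zero[OF s] less by (subst sums_zero_iff_shift) auto
    then have "(\<lambda>i. d (i + n) * s ^ (i + n) / s ^ n) sums (0 / s ^ n)" by (rule sums_divide)
    then show ?thesis using s by (simp add: power_add)
  qed
  have "summable (\<lambda>i. d (i + n) * (1/2) ^ i)" using shifted[of "1/2"] by (auto simp: sums_iff)
  then have "isCont F 0" unfolding F_def by (rule isCont_powser) simp
  then have "(F \<longlongrightarrow> F 0) (at_right 0)"
    unfolding isCont_def by (rule filterlim_mono) (auto simp: at_le)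
  moreover have "(F \<longlongrightarrow> 0) (at_right 0)"
  proof (rule tendsto_eventually)
    show "\<forall>\<^sub>F s in at_right 0. F s = 0"
      unfolding eventually_at_right_field using shifted by (intro exI[of _ 1]) (auto simp: F_def sums_iff)
  qed
  ultimately have "F 0 = 0" using tendsto_unique[OF trivial_limit_at_right_real] by blast
  then show ?case by (simp add: F_def)
qed

lemma sums_pgf:
  fixes q :: "nat pmf" and s :: real
  assumes "0 \<le> s" "s \<le> 1"
  shows "(\<lambda>k. pmf q k * s ^ k) sums measure_pmf.expectation q (\<lambda>k. s ^ k)"
proof -
  have "integrable (measure_pmf q) (\<lambda>k. s ^ k)"
    using assms by (intro measure_pmf.integrable_const_bound[where B = 1]) (auto simp: power_le_one)
  then have "integrable (count_space UNIV) (\<lambda>k. pmf q k * s ^ k)"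
    unfolding measure_pmf_eq_density by (subst (asm) integrable_density) auto
  then show ?thesis
    using sums_integral_count_space_nat[of "\<lambda>k. pmf q k * s ^ k"]
    unfolding measure_pmf_eq_density by (subst integral_density) auto
qed

lemma pmf_eqI_pgf:
  fixes p q :: "nat pmf"
  assumes "\<And>s::real. 0 < s \<Longrightarrow> s < 1 \<Longrightarrow>
    measure_pmf.expectation p (\<lambda>k. s ^ k) = measure_pmf.expectation q (\<lambda>k. s ^ k)"
  shows "p = q"
proof (rule pmf_eqI)
  fix n
  have "pmf p n - pmf q n = 0"
  proof (rule power_series_zero_imp)
    fix s :: real assume s: "0 < s" "s < 1"
    have "(\<lambda>k. pmf p k * s ^ k - pmf q k * s ^ k) sums
        (measure_pmf.expectation p (\<lambda>k. s ^ k) - measure_pmf.expectation q (\<lambda>k. s ^ k))"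
      using s by (intro sums_diff sums_pgf) auto
    then show "(\<lambda>k. (pmf p k - pmf q k) * s ^ k) sums 0"
      using assms s by (simp add: left_diff_distrib)
  qed
  then show "pmf p n = pmf q n" by simp
qed

lemma pgf_poisson0:
  fixes r s :: real
  assumes "r \<ge> 0" "0 \<le> s" "s \<le> 1"
  shows "measure_pmf.expectation (poisson0_pmf r) (\<lambda>k. s ^ k) = exp (r * (s - 1))"
proof -
  have "(\<lambda>k. (r * s) ^ k /\<^sub>R fact k * exp (- r)) sums (exp (r * s) * exp (- r))"
    by (intro sums_mult2 exp_converges)
  then have "(\<lambda>k. pmf (poisson0_pmf r) k * s ^ k) sums (exp (r * s) * exp (- r))"
    using assms by (simp add: pmf_poisson0 power_mult_distrib divide_inverse mult_ac)
  then have "measure_pmf.expectation (poisson0_pmf r) (\<lambda>k. s ^ k) = exp (r * s) * exp (- r)"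
    using sums_pgf[of s "poisson0_pmf r"] assms sums_unique2 by blast
  then show ?thesis by (simp add: exp_add[symmetric] algebra_simps)
qed

lemma nat_distr_is_pmf:
  assumes "prob_space D" and sets: "sets D = (UNIV :: nat set set)"
  obtains q where "measure_pmf q = D"
proof -
  interpret prob_space D by fact
  have "AE k in D. measure D {k} \<noteq> 0"
  proof (rule AE_I')
    have "(\<Union>k\<in>{k. measure D {k} = 0}. {k}) \<in> null_sets D"
      using sets by (intro null_sets_UN') (auto simp: null_sets_def emeasure_eq_measure)
    then show "{k. measure D {k} = 0} \<in> null_sets D" by simp
  qed auto
  then have "measure_pmf (Abs_pmf D) = D"
    using assms by (intro Abs_pmf_inverse) auto
  then show ?thesis using that by blast
qed

definition hypergraph_rate :: "(nat \<Rightarrow> real) \<Rightarrow> nat \<Rightarrow> nat \<Rightarrow> real" where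
  "hypergraph_rate \<beta> N j = real N * \<beta> j / real (N choose j)"

lemma hypergraph_rate_nonneg: "(\<And>j. \<beta> j \<ge> 0) \<Longrightarrow> hypergraph_rate \<beta> N j \<ge> 0"
  by (simp add: hypergraph_rate_def)

text \<open>The definition prescribes the law of the number of hyperedges of each size only. It is a sum of
independent and identically distributed counts, so the generating function of a single count on
\<open>(0, 1)\<close> is the non-negative \<open>n\<close>-th root of a Poisson one, which is Poisson again with the rate
divided by \<open>n\<close>.\<close>

lemma poisson_hypergraph_edge_law:
  assumes P: "poisson_hypergraph M V \<beta> \<Lambda>" and \<beta>: "\<And>j. \<beta> j \<ge> 0" and A: "A \<subseteq> V"
  shows "distr M (count_space UNIV) (\<lambda>\<omega>. \<Lambda> \<omega> A) =
    measure_pmf (poisson0_pmf (hypergraph_rate \<beta> (card V) (card A)))"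
proof -
  interpret prob_space M using P by (simp add: poisson_hypergraph_def)
  let ?j = "card A" and ?N = "card V"
  define I where "I = {B. B \<subseteq> V \<and> card B = ?j}"
  define r where "r = real ?N * \<beta> ?j / real (?N choose ?j)"
  have finV: "finite V" using P by (simp add: poisson_hypergraph_def)
  have jN: "?j \<le> ?N" using A finV card_mono by blast
  then have n: "?N choose ?j > 0" by simp
  have cI: "card I = ?N choose ?j" unfolding I_def by (rule n_subsets[OF finV])
  have finI: "finite I" using finV by (auto simp: I_def)
  have r: "r \<ge> 0" using \<beta> by (simp add: r_def)
  have indep: "indep_vars (\<lambda>_. count_space UNIV) (\<lambda>B \<omega>. \<Lambda> \<omega> B) I"
    using P by (auto simp: poisson_hypergraph_def I_def intro: indep_vars_subset)
  have rv: "(\<lambda>\<omega>. \<Lambda> \<omega> B) \<in> measurable M (count_space UNIV)" if "B \<in> I" for B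
    using indep that by (auto simp: indep_vars_def)
  have AI: "A \<in> I" using A by (simp add: I_def)
  obtain q where q: "measure_pmf q = distr M (count_space UNIV) (\<lambda>\<omega>. \<Lambda> \<omega> A)"
    by (rule nat_distr_is_pmf[OF prob_space_distr[OF rv[OF AI]]]) auto
  have qB: "measure_pmf q = distr M (count_space UNIV) (\<lambda>\<omega>. \<Lambda> \<omega> B)" if "B \<in> I" for B
  proof -
    have "\<forall>A\<in>Pow V. \<forall>B\<in>Pow V. card A = card B \<longrightarrow>
        distr M (count_space UNIV) (\<lambda>\<omega>. \<Lambda> \<omega> A) = distr M (count_space UNIV) (\<lambda>\<omega>. \<Lambda> \<omega> B)"
      using P unfolding poisson_hypergraph_def by (elim conjE)
    moreover have "A \<in> Pow V" "B \<in> Pow V" "card A = card B" using A that by (auto simp: I_def)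
    ultimately show ?thesis using q by metis
  qed
  have sum_law: "distr M (count_space UNIV) (\<lambda>\<omega>. \<Sum>B\<in>I. \<Lambda> \<omega> B) =
      measure_pmf (poisson0_pmf (real ?N * \<beta> ?j))"
    using P jN by (simp add: poisson_hypergraph_def I_def)
  have "q = poisson0_pmf r"
  proof (rule pmf_eqI_pgf)
    fix s :: real assume s: "0 < s" "s < 1"
    let ?g = "measure_pmf.expectation q (\<lambda>k. s ^ k)"
    have bound: "integrable M (\<lambda>\<omega>. s ^ X \<omega>)" if "X \<in> measurable M (count_space UNIV)" for X :: "_ \<Rightarrow> nat"
    proof (rule integrable_const_bound[where B = 1])
      show "(\<lambda>\<omega>. s ^ X \<omega>) \<in> borel_measurable M"
        by (rule measurable_compose[OF that]) simp
    qed (use s in \<open>auto simp: power_le_one\<close>)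
    have g: "?g = expectation (\<lambda>\<omega>. s ^ \<Lambda> \<omega> B)" if "B \<in> I" for B
      using rv[OF that] by (subst qB[OF that]) (simp add: integral_distr)
    have rv_sum: "(\<lambda>\<omega>. \<Sum>B\<in>I. \<Lambda> \<omega> B) \<in> measurable M (count_space UNIV)"
      using rv by measurable
    have "?g ^ card I = (\<Prod>B\<in>I. expectation (\<lambda>\<omega>. s ^ \<Lambda> \<omega> B))"
      by (subst prod.cong[OF refl g[symmetric]]) auto
    also have "\<dots> = expectation (\<lambda>\<omega>. \<Prod>B\<in>I. s ^ \<Lambda> \<omega> B)"
      using bound rv
      by (intro indep_vars_lebesgue_integral[symmetric] finI
            indep_vars_compose2[OF indep, where Y = "\<lambda>_ k. s ^ k"]) auto
    also have "\<dots> = expectation (\<lambda>\<omega>. s ^ (\<Sum>B\<in>I. \<Lambda> \<omega> B))" by (simp add: power_sum)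
    also have "\<dots> = measure_pmf.expectation (poisson0_pmf (real ?N * \<beta> ?j)) (\<lambda>k. s ^ k)"
      unfolding sum_law[symmetric] using rv_sum by (simp add: integral_distr)
    also have "\<dots> = exp (real ?N * \<beta> ?j * (s - 1))" using s \<beta> by (simp add: pgf_poisson0)
    also have "real ?N * \<beta> ?j * (s - 1) = real (card I) * (r * (s - 1))"
      using n by (simp add: r_def cI)
    also have "exp \<dots> = exp (r * (s - 1)) ^ card I" by (rule exp_of_nat_mult)
    finally have "?g = exp (r * (s - 1))"
      using s n by (subst (asm) power_eq_iff_eq_base) (auto simp: cI intro!: Bochner_Integration.integral_nonneg)
    then show "?g = measure_pmf.expectation (poisson0_pmf r) (\<lambda>k. s ^ k)"
      using s r by (simp add: pgf_poisson0)
  qed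
  then show ?thesis using q by (simp add: r_def hypergraph_rate_def)
qed

text \<open>Events of the hypergraph may be computed under \<open>hypergraph_pmf\<close>. Functions that vanish outside
\<open>Pow V\<close> form a countable set, so joint measurability and the joint law follow from single points.\<close>

lemma poisson_hypergraph_law:
  fixes \<Lambda> :: "'a \<Rightarrow> 'v set \<Rightarrow> nat" and V :: "'v set"
  assumes P: "poisson_hypergraph M V \<beta> \<Lambda>" and \<beta>: "\<And>j. \<beta> j \<ge> 0"
    and cong: "\<And>L L'. (\<And>A. A \<subseteq> V \<Longrightarrow> L A = L' A) \<Longrightarrow> E L = E L'"
  defines "r \<equiv> hypergraph_rate \<beta> (card V)"
  shows "{\<omega> \<in> space M. E (\<Lambda> \<omega>)} \<in> sets M"
    and "measure M {\<omega> \<in> space M. E (\<Lambda> \<omega>)} = measure_pmf.prob (hypergraph_pmf r V) {L. E L}"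
proof -
  interpret prob_space M using P by (simp add: poisson_hypergraph_def)
  have finV: "finite V" using P by (simp add: poisson_hypergraph_def)
  have indep: "indep_vars (\<lambda>_. count_space UNIV) (\<lambda>A \<omega>. \<Lambda> \<omega> A) (Pow V)"
    using P by (simp add: poisson_hypergraph_def)
  have rv[measurable]: "(\<lambda>\<omega>. \<Lambda> \<omega> A) \<in> measurable M (count_space UNIV)" if "A \<in> Pow V" for A
    using indep that by (auto simp: indep_vars_def)
  define X where "X \<omega> A = (if A \<in> Pow V then \<Lambda> \<omega> A else 0)" for \<omega> A
  define C where "C = PiE_dflt (Pow V) 0 (\<lambda>_. UNIV :: nat set)"
  have C: "L \<in> C \<longleftrightarrow> (\<forall>A. A \<notin> Pow V \<longrightarrow> L A = 0)" for L by (auto simp: C_def PiE_dflt_def)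
  have cC: "countable C"
    unfolding C_def dflt_image_PiE[symmetric] using finV by (intro countable_image countable_PiE) auto
  have XC: "X \<omega> \<in> C" for \<omega> by (auto simp: C X_def)
  have vimage: "X -` {L} \<inter> space M = (\<Inter>A\<in>Pow V. (\<lambda>\<omega>. \<Lambda> \<omega> A) -` {L A} \<inter> space M)" if "L \<in> C" for L
    using that by (auto simp: X_def C fun_eq_iff)
  have meas1: "X -` {L} \<inter> space M \<in> sets M" if "L \<in> C" for L
    unfolding vimage[OF that] using finV rv
    by (intro sets.finite_INT) (auto intro: measurable_sets)
  have X: "X \<in> measurable M (count_space UNIV)"
  proof (rule measurableI)
    fix B :: "('v set \<Rightarrow> nat) set"
    have "X -` B \<inter> space M = (\<Union>L\<in>B \<inter> C. X -` {L} \<inter> space M)" using XC by auto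
    also have "\<dots> \<in> sets M" using cC meas1 by (intro sets.countable_UN') auto
    finally show "X -` B \<inter> space M \<in> sets M" .
  qed auto
  have law: "distr M (count_space UNIV) X = measure_pmf (hypergraph_pmf r V)"
  proof (rule measure_eqI_countable_AE[where \<Omega> = C])
    show "AE L in distr M (count_space UNIV) X. L \<in> C" using X XC by (subst AE_distr_iff) auto
    show "AE L in measure_pmf (hypergraph_pmf r V). L \<in> C"
      using set_Pi_pmf_subset[of "Pow V" 0 "\<lambda>A. poisson0_pmf (r (card A))"] finV
      unfolding AE_measure_pmf_iff hypergraph_pmf_def C by blast
    fix L assume L: "L \<in> C"
    have edge: "prob ((\<lambda>\<omega>. \<Lambda> \<omega> A) -` {L A} \<inter> space M) = pmf (poisson0_pmf (r (card A))) (L A)"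
      if "A \<in> Pow V" for A
    proof -
      have "prob ((\<lambda>\<omega>. \<Lambda> \<omega> A) -` {L A} \<inter> space M) =
          measure (distr M (count_space UNIV) (\<lambda>\<omega>. \<Lambda> \<omega> A)) {L A}"
        using rv[OF that] by (simp add: measure_distr)
      also have "\<dots> = pmf (poisson0_pmf (r (card A))) (L A)"
        using poisson_hypergraph_edge_law[OF P, of A] \<beta> that
        by (simp add: r_def measure_pmf_single)
      finally show ?thesis .
    qed
    have "measure (distr M (count_space UNIV) X) {L} = prob (X -` {L} \<inter> space M)"
      using X by (simp add: measure_distr)
    also have "\<dots> = (\<Prod>A\<in>Pow V. prob ((\<lambda>\<omega>. \<Lambda> \<omega> A) -` {L A} \<inter> space M))"
      unfolding vimage[OF L] using finV
      by (intro indep_varsD[OF indep]) auto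
    also have "\<dots> = pmf (hypergraph_pmf r V) L"
      unfolding hypergraph_pmf_def using L finV by (subst pmf_Pi') (auto simp: C edge)
    finally have "measure (distr M (count_space UNIV) X) {L} = measure_pmf.prob (hypergraph_pmf r V) {L}"
      by (simp add: measure_pmf_single)
    then show "emeasure (distr M (count_space UNIV) X) {L} = emeasure (hypergraph_pmf r V) {L}"
      using X prob_space.finite_measure[OF prob_space_distr[OF X]]
      by (simp add: finite_measure.emeasure_eq_measure measure_pmf.emeasure_eq_measure)
  qed (use cC in auto)
  have "E (X \<omega>) = E (\<Lambda> \<omega>)" for \<omega> by (rule cong) (simp add: X_def)
  then have eq: "{\<omega> \<in> space M. E (\<Lambda> \<omega>)} = X -` {L. E L} \<inter> space M" by auto
  show "{\<omega> \<in> space M. E (\<Lambda> \<omega>)} \<in> sets M"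
    unfolding eq by (rule measurable_sets[OF X]) simp
  show "measure M {\<omega> \<in> space M. E (\<Lambda> \<omega>)} = measure_pmf.prob (hypergraph_pmf r V) {L. E L}"
    unfolding eq law[symmetric] using X by (simp add: measure_distr)
qed

section \<open>The series of the reach rate and the threshold\<close>

text \<open>The real-valued counterpart of \<open>derived_series\<close>, to be used where the series converges.\<close>

definition reach_series :: "(nat \<Rightarrow> real) \<Rightarrow> real \<Rightarrow> real" where
  "reach_series \<beta> t = (\<Sum>j. real (Suc j) * \<beta> (Suc j) * t ^ j)"

lemma summable_reach_series:
  assumes \<beta>: "\<And>j. \<beta> j \<ge> 0" and t: "0 \<le> s" "s \<le> t"
    and sm: "summable (\<lambda>j. real (Suc j) * \<beta> (Suc j) * t ^ j)"
  shows "summable (\<lambda>j. real (Suc j) * \<beta> (Suc j) * s ^ j)"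
proof (rule summable_comparison_test'[where N = 0, OF sm])
  fix j
  have "s ^ j \<le> t ^ j" using t by (intro power_mono)
  then show "norm (real (Suc j) * \<beta> (Suc j) * s ^ j) \<le> real (Suc j) * \<beta> (Suc j) * t ^ j"
    using \<beta> t by (simp add: mult_left_mono)
qed

lemma reach_series_mono:
  assumes \<beta>: "\<And>j. \<beta> j \<ge> 0" and t: "0 \<le> s" "s \<le> t"
    and sm: "summable (\<lambda>j. real (Suc j) * \<beta> (Suc j) * t ^ j)"
  shows "reach_series \<beta> s \<le> reach_series \<beta> t"
  unfolding reach_series_def using summable_reach_series[where \<beta> = \<beta>, OF \<beta> t sm] sm \<beta> t
  by (intro suminf_le mult_left_mono power_mono) auto

lemma reach_series_nonneg:
  assumes "\<And>j. \<beta> j \<ge> 0" "0 \<le> t" "summable (\<lambda>j. real (Suc j) * \<beta> (Suc j) * t ^ j)"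
  shows "reach_series \<beta> t \<ge> 0"
  unfolding reach_series_def using assms by (intro suminf_nonneg) auto

lemma summable_gen_series:
  assumes \<beta>: "\<And>j. \<beta> j \<ge> 0" and t: "0 \<le> t" "t \<le> 1"
    and sm: "summable (\<lambda>j. real (Suc j) * \<beta> (Suc j) * t ^ j)"
  shows "summable (\<lambda>j. \<beta> j * t ^ j)"
proof -
  have "summable (\<lambda>j. \<beta> (Suc j) * t ^ Suc j)"
  proof (rule summable_comparison_test'[where N = 0, OF sm])
    fix j
    have "t ^ Suc j \<le> t ^ j" using t by (intro power_decreasing) auto
    also have "\<dots> \<le> real (Suc j) * t ^ j" using t mult_right_mono[of 1 "real (Suc j)" "t ^ j"] by simp
    finally have "\<beta> (Suc j) * t ^ Suc j \<le> \<beta> (Suc j) * (real (Suc j) * t ^ j)"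
      using \<beta> by (intro mult_left_mono)
    moreover have "0 \<le> \<beta> (Suc j) * t ^ Suc j" using \<beta> t by simp
    ultimately show "norm (\<beta> (Suc j) * t ^ Suc j) \<le> real (Suc j) * \<beta> (Suc j) * t ^ j"
      by (simp only: real_norm_def abs_of_nonneg) (simp only: mult_ac)
  qed
  then show ?thesis by (rule iffD1[OF summable_Suc_iff[where f = "\<lambda>j. \<beta> j * t ^ j"]])
qed

lemma continuous_on_reach_series:
  assumes t: "0 \<le> t0" "t0 < t1" and sm: "summable (\<lambda>j. real (Suc j) * \<beta> (Suc j) * t1 ^ j)"
  shows "continuous_on {0..t0} (reach_series \<beta>)"
  unfolding reach_series_def
  by (intro continuous_at_imp_continuous_on ballI isCont_powser[OF sm]) (use t in auto)

text \<open>The condition is rewritten with the exponential because \<open>exp (- reach_series \<beta> t)\<close> is the limiting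
probability of not being reached, to be compared with the fraction \<open>1 - t\<close> of vertices outside.\<close>

lemma derived_series_add_neg_iff:
  assumes \<beta>: "\<And>j. \<beta> j \<ge> 0" and t: "0 \<le> t" "t < 1"
  shows "derived_series \<beta> t + ereal (ln (1 - t)) < 0 \<longleftrightarrow>
    summable (\<lambda>j. real (Suc j) * \<beta> (Suc j) * t ^ j) \<and> 1 - t < exp (- reach_series \<beta> t)"
proof -
  let ?c = "\<lambda>j. real (Suc j) * \<beta> (Suc j) * t ^ j"
  have c: "?c j \<ge> 0" for j using \<beta> t by simp
  have fin: "derived_series \<beta> t + ereal (ln (1 - t)) < 0 \<longleftrightarrow> 1 - t < exp (- reach_series \<beta> t)"
    if "summable ?c"
  proof -
    have "derived_series \<beta> t = ereal (reach_series \<beta> t)"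
      unfolding derived_series_def reach_series_def by (rule suminf_ereal'[OF that])
    then have "derived_series \<beta> t + ereal (ln (1 - t)) < 0 \<longleftrightarrow> ln (1 - t) < - reach_series \<beta> t"
      by (simp add: zero_ereal_def) linarith
    also have "\<dots> \<longleftrightarrow> 1 - t < exp (- reach_series \<beta> t)"
      using t by (metis diff_gt_0_iff_gt exp_gt_zero exp_ln ln_exp ln_less_cancel_iff)
    finally show ?thesis .
  qed
  moreover have "summable ?c" if "derived_series \<beta> t + ereal (ln (1 - t)) < 0"
    using that c by (intro summable_ereal) (auto simp: derived_series_def)
  ultimately show ?thesis by blast
qed

text \<open>Below the infimum the difference \<open>derived_series \<beta> t + ln (1 - t)\<close> is non-negative, and it is
  non-zero because there are no zeros. Monotonicity of the series and continuity of \<open>1 - t\<close> carry the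
  inequality over to the infimum itself (if it is \<open>0\<close>, one uses \<open>\<beta> 1 \<ge> 0\<close> instead). So the infimum
  is not attained, and the difference is negative at points to its right that come arbitrarily close.
  Letting these tend to the infimum gives equality there.\<close>

lemma
  assumes \<beta>: "\<And>j. \<beta> j \<ge> 0" and z1: "z_star \<beta> < 1" and zeta: "zeta \<beta> = {}"
  shows z_star_nonneg: "0 \<le> z_star \<beta>"
    and z_star_approx: "\<And>\<epsilon>. \<epsilon> > 0 \<Longrightarrow> \<exists>t. z_star \<beta> < t \<and> t < z_star \<beta> + \<epsilon> \<and> t < 1 \<and>
      summable (\<lambda>j. real (Suc j) * \<beta> (Suc j) * t ^ j) \<and> 1 - t < exp (- reach_series \<beta> t)"
    and below_z_star: "\<And>t. 0 \<le> t \<Longrightarrow> t < z_star \<beta> \<Longrightarrow> exp (- reach_series \<beta> t) < 1 - t"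
    and at_z_star: "exp (- reach_series \<beta> (z_star \<beta>)) = 1 - z_star \<beta>"
proof -
  define z where "z = z_star \<beta>"
  let ?c = "\<lambda>t j. real (Suc j) * \<beta> (Suc j) * t ^ j" and ?g = "reach_series \<beta>"
  define S where "S = {t \<in> {0..<1}. derived_series \<beta> t + ereal (ln (1 - t)) < 0}"
  have S: "t \<in> S \<longleftrightarrow> 0 \<le> t \<and> t < 1 \<and> summable (?c t) \<and> 1 - t < exp (- ?g t)" for t
    using derived_series_add_neg_iff[of \<beta> t, OF \<beta>] by (auto simp: S_def)
  obtain t1 where t1: "0 \<le> z" "z \<le> t1" "t1 \<in> S"
    using z_star_props[OF z1] unfolding z_def S_def by force
  have bdd: "bdd_below S" by (rule bdd_belowI[of _ 0]) (simp add: S_def)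
  have z_Inf: "z = Inf S"
  proof -
    have "Inf (ereal ` S) \<ge> 0" by (rule Inf_greatest) (auto simp: S_def)
    moreover have "Inf (ereal ` S) \<le> ereal t1" using t1(3) by (intro Inf_lower) auto
    ultimately have "\<bar>Inf (ereal ` S)\<bar> \<noteq> \<infinity>" by auto
    then have "ereal (Inf S) = Inf (ereal ` S)" by (rule ereal_Inf)
    moreover have "Inf S \<le> 1" using cInf_lower[OF t1(3) bdd] t1(3) by (simp add: S)
    ultimately show ?thesis
      unfolding z_def z_star_def S_def[symmetric] by (metis ereal_less_eq(3) min.absorb1 one_ereal_def real_of_ereal.simps(1))
  qed
  have sm: "summable (?c t)" if "0 \<le> t" "t \<le> t1" for t
    using summable_reach_series[of \<beta> t t1] \<beta> that t1(3) by (simp add: S)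
  have mono: "?g s \<le> ?g t" if "0 \<le> s" "s \<le> t" "t \<le> t1" for s t
    using reach_series_mono[of \<beta> s t] \<beta> that sm[of t] by simp
  have below: "exp (- ?g t) < 1 - t" if t: "0 \<le> t" "t < z" for t
  proof -
    have "t \<notin> S" using cInf_lower[OF _ bdd, of t] t z_Inf by auto
    then have "derived_series \<beta> t + ereal (ln (1 - t)) \<ge> 0"
      using t z1 by (auto simp: S_def z_def not_less)
    moreover have "derived_series \<beta> t + ereal (ln (1 - t)) \<noteq> 0"
      using zeta t by (auto simp: zeta_def z_def)
    moreover have "derived_series \<beta> t = ereal (?g t)"
      unfolding derived_series_def reach_series_def using t t1 by (intro suminf_ereal' sm) auto
    ultimately have "- ?g t < ln (1 - t)" by (simp add: zero_ereal_def)
    then show ?thesis using t z1 unfolding z_def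
      by (metis diff_gt_0_iff_gt exp_less_cancel_iff exp_ln less_trans)
  qed
  have at_le: "exp (- ?g z) \<le> 1 - z"
  proof (cases "z = 0")
    case True
    then show ?thesis using \<beta>[of 1] by (simp add: reach_series_def)
  next
    case False
    show ?thesis
    proof (rule ccontr)
      assume "\<not> ?thesis"
      then have "max 0 (1 - exp (- ?g z)) < z" using t1 False by auto
      then obtain s where s: "max 0 (1 - exp (- ?g z)) < s" "s < z" using dense by blast
      then have "exp (- ?g s) < 1 - s" using below by auto
      moreover have "exp (- ?g z) \<le> exp (- ?g s)" using mono[of s z] s t1 by simp
      ultimately show False using s(1) by linarith
    qed
  qed
  have approx: "\<exists>t. z < t \<and> t < z + \<epsilon> \<and> t < 1 \<and> summable (?c t) \<and> 1 - t < exp (- ?g t)"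
    if "\<epsilon> > 0" for \<epsilon>
  proof -
    have "S \<noteq> {}" using t1 by auto
    moreover have "Inf S < z + \<epsilon>" using \<open>\<epsilon> > 0\<close> z_Inf by simp
    ultimately obtain t where t: "t \<in> S" "t < z + \<epsilon>" by (meson cInf_lessD)
    have "z \<le> t" using cInf_lower[OF t(1) bdd] z_Inf by simp
    moreover have "t \<noteq> z" using t(1) at_le S[of z] by auto
    ultimately have "z < t" by simp
    then show ?thesis using t S[of t] by blast
  qed
  have at_ge: "exp (- ?g z) \<ge> 1 - z"
  proof (rule field_le_epsilon)
    fix e :: real assume "e > 0"
    have "z \<noteq> t1" using t1(3) at_le S[of z] by auto
    then have "min e (t1 - z) > 0" using \<open>e > 0\<close> t1 by simp
    from approx[OF this] obtain t where t: "z < t" "t < z + e" "t < t1" "1 - t < exp (- ?g t)"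
      by (auto simp: min_def split: if_splits)
    have "?g z \<le> ?g t" using mono[of z t] t t1 by simp
    then have "exp (- ?g t) \<le> exp (- ?g z)" by simp
    then show "1 - z \<le> exp (- ?g z) + e" using t by linarith
  qed
  show "0 \<le> z_star \<beta>" using t1 by (simp add: z_def)
  show "\<exists>t. z_star \<beta> < t \<and> t < z_star \<beta> + \<epsilon> \<and> t < 1 \<and> summable (?c t) \<and> 1 - t < exp (- ?g t)"
    if "\<epsilon> > 0" for \<epsilon> using approx[OF that] by (simp add: z_def)
  show "exp (- ?g t) < 1 - t" if "0 \<le> t" "t < z_star \<beta>" for t using below that by (simp add: z_def)
  show "exp (- ?g (z_star \<beta>)) = 1 - z_star \<beta>" using at_le at_ge by (simp add: z_def)
qed

section \<open>Uniform limits of the rates\<close>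

lemma binomial_ratio_prod:
  assumes "j \<le> k" "k \<le> n"
  shows "real (k choose j) / real (n choose j) = (\<Prod>i<j. real (k - i) / real (n - i))"
proof -
  have "real (k choose j) = (\<Prod>i<j. real (k - i) / real (j - i))"
    "real (n choose j) = (\<Prod>i<j. real (n - i) / real (j - i))"
    using assms by (simp_all add: binomial_altdef_of_nat atLeast0LessThan)
  moreover have "real (j - i) \<noteq> 0" if "i < j" for i using that by simp
  ultimately show ?thesis
    by (simp add: prod_dividef[symmetric])
qed

lemma binomial_ratio_le:
  assumes "k \<le> n"
  shows "real (k choose j) / real (n choose j) \<le> (real k / real n) ^ j"
proof (cases "j \<le> k")
  case True
  have "(\<Prod>i<j. real (k - i) / real (n - i)) \<le> (\<Prod>i<j. real k / real n)"
  proof (rule prod_mono, rule conjI)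
    fix i assume "i \<in> {..<j}"
    then have i: "i < k" "i < n" using True assms by auto
    have "real i * real k \<le> real i * real n" using assms by (intro mult_left_mono) auto
    then have "(real k - real i) * real n \<le> real k * (real n - real i)" by (simp add: algebra_simps)
    then show "real (k - i) / real (n - i) \<le> real k / real n"
      using i by (simp add: frac_le_eq divide_simps of_nat_diff)
  qed simp
  then show ?thesis using binomial_ratio_prod[OF True assms] by simp
qed (simp add: binomial_eq_0)

text \<open>For \<open>j > k\<close> both sides vanish, the left one because \<open>k - J\<close> is truncated to \<open>0\<close>.\<close>

lemma binomial_ratio_ge:
  assumes "k \<le> n" "j \<le> J"
  shows "(real (k - J) / real n) ^ j \<le> real (k choose j) / real (n choose j)"
proof (cases "j \<le> k")
  case True
  have "(\<Prod>i<j. real (k - J) / real n) \<le> (\<Prod>i<j. real (k - i) / real (n - i))"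
  proof (rule prod_mono, rule conjI)
    fix i assume "i \<in> {..<j}"
    then have i: "i < k" "i < n" "i \<le> J" using True assms by auto
    then show "real (k - J) / real n \<le> real (k - i) / real (n - i)"
      by (intro frac_le) auto
  qed simp
  then show ?thesis using binomial_ratio_prod[OF True assms(1)] by simp
next
  case False
  then have "k - J = 0" "j > 0" using assms by auto
  then show ?thesis by (simp add: power_0_left)
qed

text \<open>Each \<open>c j\<close> is weighted with the probability that a uniformly random \<open>j\<close>-subset of an \<open>n\<close>-set lies
in a fixed \<open>k\<close>-subset. For large \<open>n\<close> this is close to \<open>(k / n) ^ j\<close>.\<close>

definition hyper_sum :: "(nat \<Rightarrow> real) \<Rightarrow> nat \<Rightarrow> nat \<Rightarrow> real" where
  "hyper_sum c n k = (\<Sum>j\<le>k. c j * (real (k choose j) / real (n choose j)))"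

text \<open>From above, the ratios are at most \<open>(k / n) ^ j\<close>. From below, the first \<open>J\<close> ratios are at least
\<open>((k - J) / n) ^ j\<close>, and \<open>J\<close> is chosen such that the tail of the series at \<open>t1\<close> is small. Uniform
continuity of the series takes care of the shifts of the argument. The argument \<open>s\<close> is allowed to
differ from \<open>k / n\<close> by \<open>1 / n\<close> because \<open>s = k / N\<close> will be used with \<open>n = N\<close> and \<open>n = N - 1\<close>.\<close>

lemma hyper_sum_uniform_limit:
  fixes c :: "nat \<Rightarrow> real"
  assumes c: "\<And>j. c j \<ge> 0" and t: "0 \<le> t0" "t0 < t1" "t1 \<le> 1"
    and sm: "summable (\<lambda>j. c j * t1 ^ j)" and e: "\<epsilon> > 0"
  defines "g \<equiv> \<lambda>s. \<Sum>j. c j * s ^ j"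
  shows "\<exists>n0>0. \<forall>n\<ge>n0. \<forall>k s. 0 \<le> s \<and> s \<le> t0 \<and> \<bar>s * real n - real k\<bar> \<le> 1 \<longrightarrow>
    k \<le> n \<and> \<bar>hyper_sum c n k - g s\<bar> \<le> \<epsilon>"
proof -
  define t' where "t' = (t0 + t1) / 2"
  have t': "t0 < t'" "t' < t1" "0 \<le> t'" using t by (auto simp: t'_def)
  have sums: "summable (\<lambda>j. c j * s ^ j)" if "0 \<le> s" "s \<le> t1" for s
    using that c by (intro summable_comparison_test'[OF sm]) (auto intro!: mult_left_mono power_mono)
  have "continuous_on {0..t'} g"
    unfolding g_def
    by (intro continuous_at_imp_continuous_on ballI isCont_powser[OF sm]) (use t' in auto)
  then have "uniformly_continuous_on {0..t'} g"
    by (rule compact_uniformly_continuous) simp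
  then obtain \<delta> where \<delta>: "\<delta> > 0"
    "\<And>s s'. s \<in> {0..t'} \<Longrightarrow> s' \<in> {0..t'} \<Longrightarrow> \<bar>s' - s\<bar> < \<delta> \<Longrightarrow> \<bar>g s' - g s\<bar> < \<epsilon> / 2"
    unfolding uniformly_continuous_on_def dist_real_def using e by (metis half_gt_zero)
  have "(\<lambda>J. \<Sum>j<J. c j * t1 ^ j) \<longlonglongrightarrow> g t1"
    unfolding g_def using sm by (rule summable_LIMSEQ)
  then have "\<forall>\<^sub>F J in sequentially. \<bar>(\<Sum>j<J. c j * t1 ^ j) - g t1\<bar> < \<epsilon> / 2"
    using e unfolding tendsto_iff dist_real_def by (metis half_gt_zero)
  then obtain J where J: "\<bar>(\<Sum>j<J. c j * t1 ^ j) - g t1\<bar> < \<epsilon> / 2"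
    by (auto simp: eventually_sequentially)
  have tail: "g s - (\<Sum>j<J. c j * s ^ j) \<le> \<epsilon> / 2" if s: "0 \<le> s" "s \<le> t1" for s
  proof -
    have split: "g s = (\<Sum>j. c (j + J) * s ^ (j + J)) + (\<Sum>j<J. c j * s ^ j)"
      if "0 \<le> s" "s \<le> t1" for s
      unfolding g_def by (rule suminf_split_initial_segment[OF sums[OF that]])
    have "(\<Sum>j. c (j + J) * s ^ (j + J)) \<le> (\<Sum>j. c (j + J) * t1 ^ (j + J))"
      using s c sums[OF s] sm
      by (intro suminf_le mult_left_mono power_mono summable_ignore_initial_segment) auto
    then show ?thesis using split[OF s] split[of t1] J t by auto
  qed
  define \<eta> where "\<eta> = min \<delta> (t' - t0)"
  have \<eta>: "\<eta> > 0" "\<eta> \<le> \<delta>" "\<eta> \<le> t' - t0" using \<delta>(1) t' by (auto simp: \<eta>_def)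
  define n0 where "n0 = nat \<lceil>(real J + 2) / \<eta>\<rceil> + 1"
  have main: "k \<le> n \<and> \<bar>hyper_sum c n k - g s\<bar> \<le> \<epsilon>"
    if n: "n \<ge> n0" and s: "0 \<le> s" "s \<le> t0" "\<bar>s * real n - real k\<bar> \<le> 1" for n k s
  proof -
    have n_pos: "real n > 0" using n by (simp add: n0_def)
    have "(real J + 2) / \<eta> < real n" using n unfolding n0_def by linarith
    then have "(real J + 2) / real n < \<eta>" using n_pos \<eta>(1) by (simp add: field_simps)
    then have small: "(real J + 1) / real n + 1 / real n < \<eta>"
      by (simp add: add_divide_distrib[symmetric] add.commute)
    have small': "1 / real n < \<eta>" "(real J + 1) / real n < \<eta>"
      using small n_pos by (smt (verit) divide_nonneg_nonneg of_nat_0_le_iff)+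
    have dk: "\<bar>real k / real n - s\<bar> \<le> 1 / real n"
    proof -
      have "real k / real n - s = (real k - s * real n) / real n" using n_pos by (simp add: field_simps)
      then show ?thesis using s(3) n_pos by (simp add: divide_right_mono abs_minus_commute)
    qed
    have k_le: "real k / real n \<le> t'"
      using dk small'(1) s(2) \<eta>(3) by linarith
    then have "real k / real n \<le> 1" using t' t by linarith
    then have kn: "k \<le> n" using n_pos by simp
    define u where "u = real (k - J) / real n"
    have du: "\<bar>u - s\<bar> \<le> (real J + 1) / real n"
    proof -
      have "\<bar>u - real k / real n\<bar> = \<bar>real (k - J) - real k\<bar> / real n"
        using n_pos by (simp add: u_def diff_divide_distrib[symmetric])
      also have "\<dots> \<le> real J / real n" by (intro divide_right_mono) linarith+
      finally show ?thesis using dk by (simp add: add_divide_distrib)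
    qed
    have "u \<le> real k / real n" unfolding u_def by (intro divide_right_mono) auto
    then have u: "0 \<le> u" "u \<le> t'" using k_le by (auto simp: u_def)
    have "hyper_sum c n k \<le> (\<Sum>j\<le>k. c j * (real k / real n) ^ j)"
      unfolding hyper_sum_def using c kn by (intro sum_mono mult_left_mono binomial_ratio_le)
    also have "\<dots> \<le> g (real k / real n)"
      unfolding g_def using k_le t' c by (intro sum_le_suminf sums) auto
    also have "\<dots> \<le> g s + \<epsilon> / 2"
    proof -
      have "\<bar>real k / real n - s\<bar> < \<delta>" using dk small'(1) \<eta>(2) by linarith
      moreover have "s \<in> {0..t'}" "real k / real n \<in> {0..t'}" using k_le s t' by auto
      ultimately show ?thesis using \<delta>(2)[of s "real k / real n"] by linarith
    qed
    finally have upper: "hyper_sum c n k \<le> g s + \<epsilon> / 2" .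
    have "g s \<le> g u + \<epsilon> / 2"
    proof -
      have "\<bar>u - s\<bar> < \<delta>" using du small'(2) \<eta>(2) by linarith
      moreover have "s \<in> {0..t'}" "u \<in> {0..t'}" using u s t' by auto
      ultimately show ?thesis using \<delta>(2)[of s u] by linarith
    qed
    also have "g u \<le> (\<Sum>j<J. c j * u ^ j) + \<epsilon> / 2" using tail[of u] u t' by simp
    also have "(\<Sum>j<J. c j * u ^ j) \<le> (\<Sum>j<J. c j * (real (k choose j) / real (n choose j)))"
      unfolding u_def using c kn by (intro sum_mono mult_left_mono binomial_ratio_ge) auto
    also have "\<dots> = (\<Sum>j\<in>{..<J} \<inter> {..k}. c j * (real (k choose j) / real (n choose j)))"
      by (rule sum.mono_neutral_right) auto
    also have "\<dots> \<le> hyper_sum c n k"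
      unfolding hyper_sum_def using c by (intro sum_mono2) auto
    finally have "g s \<le> hyper_sum c n k + \<epsilon>" by simp
    with upper kn e show ?thesis by auto
  qed
  then show ?thesis by (intro exI[of _ n0]) (auto simp: n0_def)
qed

lemma inner_rate_hypergraph: "inner_rate (hypergraph_rate \<beta> N) k = real N * hyper_sum \<beta> N k"
  by (simp add: inner_rate_def hypergraph_rate_def hyper_sum_def sum_distrib_left mult_ac)

text \<open>The absorption identity \<open>(j + 1) * (N choose (j + 1)) = N * ((N - 1) choose j)\<close> turns the rates
\<open>N * \<beta> (j + 1) / (N choose (j + 1))\<close> into the coefficients of the derived series.\<close>

lemma reach_rate_hypergraph:
  assumes "N \<ge> 1" "k \<le> N - 1"
  shows "reach_rate (hypergraph_rate \<beta> N) k = hyper_sum (\<lambda>j. real (Suc j) * \<beta> (Suc j)) (N - 1) k"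
  unfolding reach_rate_def hypergraph_rate_def hyper_sum_def
proof (rule sum.cong[OF refl])
  fix j assume "j \<in> {..k}"
  then have j: "j \<le> N - 1" using assms by simp
  obtain n where n: "N = Suc n" using assms(1) by (cases N) auto
  have "Suc j * (N choose Suc j) = N * (N - 1 choose j)"
    using Suc_times_binomial_eq[of n j] n by simp
  then have "real (Suc j) * real (N choose Suc j) = real N * real (N - 1 choose j)"
    by (metis of_nat_mult)
  moreover have "N choose Suc j > 0" "N - 1 choose j > 0" using j n by auto
  ultimately have "real N / real (N choose Suc j) = real (Suc j) / real (N - 1 choose j)"
    by (simp add: field_simps)
  then have "real N * \<beta> (Suc j) / real (N choose Suc j) = real (Suc j) / real (N - 1 choose j) * \<beta> (Suc j)"
    by (metis times_divide_eq_left)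
  then show "real (k choose j) * (real N * \<beta> (Suc j) / real (N choose Suc j)) =
      real (Suc j) * \<beta> (Suc j) * (real (k choose j) / real (N - 1 choose j))"
    by simp
qed

lemma abs_exp_minus_diff_le:
  fixes a b :: real
  assumes "a \<ge> 0" "b \<ge> 0"
  shows "\<bar>exp (- a) - exp (- b)\<bar> \<le> \<bar>a - b\<bar>"
proof -
  have *: "exp (- a) - exp (- b) \<le> b - a" "exp (- b) \<le> exp (- a)" if "0 \<le> a" "a \<le> b" for a b :: real
  proof -
    define c where "c = b - a"
    have "exp (- a) - exp (- b) = exp (- a) * (1 - exp (- c))"
      by (simp add: c_def algebra_simps exp_add[symmetric])
    also have "\<dots> \<le> 1 * (1 - exp (- c))" using that by (intro mult_right_mono) (auto simp: c_def)
    also have "\<dots> \<le> c" using exp_ge_add_one_self[of "- c"] by simp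
    also have "c = b - a" by (rule c_def)
    finally show "exp (- a) - exp (- b) \<le> b - a" .
    show "exp (- b) \<le> exp (- a)" using that by simp
  qed
  show ?thesis using *[of a b] *[of b a] assms by (cases "a \<le> b") auto
qed

lemma reach_rate_uniform_limit:
  assumes \<beta>: "\<And>j. \<beta> j \<ge> 0" and t: "0 \<le> t0" "t0 < t1" "t1 \<le> 1"
    and sm: "summable (\<lambda>j. real (Suc j) * \<beta> (Suc j) * t1 ^ j)" and e: "\<epsilon> > 0"
  shows "\<forall>\<^sub>F N in sequentially. \<forall>k. real k \<le> t0 * real N \<longrightarrow>
    k < N \<and> \<bar>reach_rate (hypergraph_rate \<beta> N) k - reach_series \<beta> (real k / real N)\<bar> \<le> \<epsilon>"
proof -
  let ?c = "\<lambda>j. real (Suc j) * \<beta> (Suc j)"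
  have "\<exists>n0>0. \<forall>n\<ge>n0. \<forall>k s. 0 \<le> s \<and> s \<le> t0 \<and> \<bar>s * real n - real k\<bar> \<le> 1 \<longrightarrow>
      k \<le> n \<and> \<bar>hyper_sum ?c n k - (\<Sum>j. ?c j * s ^ j)\<bar> \<le> \<epsilon>"
    using \<beta> by (intro hyper_sum_uniform_limit[OF _ t sm e]) simp
  then obtain n0 where n0: "n0 > 0" "\<And>n k s. n \<ge> n0 \<Longrightarrow> 0 \<le> s \<Longrightarrow> s \<le> t0 \<Longrightarrow>
      \<bar>s * real n - real k\<bar> \<le> 1 \<Longrightarrow> k \<le> n \<and> \<bar>hyper_sum ?c n k - (\<Sum>j. ?c j * s ^ j)\<bar> \<le> \<epsilon>"
    by blast
  show ?thesis
    unfolding eventually_sequentially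
  proof (intro exI[of _ "Suc n0"] allI impI)
    fix N k assume N: "Suc n0 \<le> N" and k: "real k \<le> t0 * real N"
    then have Npos: "real N > 0" by simp
    let ?s = "real k / real N"
    have s: "0 \<le> ?s" "?s \<le> t0" using k Npos by (auto simp: divide_le_eq)
    then have "?s \<le> 1" using t by linarith
    have "?s * real (N - 1) - real k = - ?s" using N Npos by (simp add: of_nat_diff field_simps)
    then have "\<bar>?s * real (N - 1) - real k\<bar> \<le> 1" using s(1) \<open>?s \<le> 1\<close> by simp
    then have *: "k \<le> N - 1" "\<bar>hyper_sum ?c (N - 1) k - (\<Sum>j. ?c j * ?s ^ j)\<bar> \<le> \<epsilon>"
      using n0(2)[of "N - 1" ?s k] N s by auto
    then have "k < N" using N by simp
    with * show "k < N \<and> \<bar>reach_rate (hypergraph_rate \<beta> N) k - reach_series \<beta> ?s\<bar> \<le> \<epsilon>"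
      using N by (simp add: reach_rate_hypergraph reach_series_def)
  qed
qed

lemma reach_prob_uniform_limit:
  assumes \<beta>: "\<And>j. \<beta> j \<ge> 0" and t: "0 \<le> t0" "t0 < t1" "t1 \<le> 1"
    and sm: "summable (\<lambda>j. real (Suc j) * \<beta> (Suc j) * t1 ^ j)" and e: "\<epsilon> > 0"
  shows "\<forall>\<^sub>F N in sequentially. \<forall>k. real k \<le> t0 * real N \<longrightarrow>
    \<bar>reach_prob (hypergraph_rate \<beta> N) k - (1 - exp (- reach_series \<beta> (real k / real N)))\<bar> \<le> \<epsilon>"
  using reach_rate_uniform_limit[where \<beta> = \<beta>, OF assms]
proof (eventually_elim, intro allI impI)
  fix N k
  assume *: "\<forall>k. real k \<le> t0 * real N \<longrightarrow>
    k < N \<and> \<bar>reach_rate (hypergraph_rate \<beta> N) k - reach_series \<beta> (real k / real N)\<bar> \<le> \<epsilon>"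
    and k: "real k \<le> t0 * real N"
  let ?s = "real k / real N"
  have s: "0 \<le> ?s" "?s \<le> t1" using *[rule_format, OF k] k t by (auto simp: divide_le_eq intro: order_trans mult_right_mono)
  have "reach_series \<beta> ?s \<ge> 0"
    using reach_series_nonneg[of \<beta> ?s] summable_reach_series[of \<beta> ?s t1] \<beta> s sm by simp
  moreover have "reach_rate (hypergraph_rate \<beta> N) k \<ge> 0"
    using reach_rate_nonneg hypergraph_rate_nonneg \<beta> by blast
  ultimately have "\<bar>exp (- reach_rate (hypergraph_rate \<beta> N) k) - exp (- reach_series \<beta> ?s)\<bar> \<le>
      \<bar>reach_rate (hypergraph_rate \<beta> N) k - reach_series \<beta> ?s\<bar>"
    by (intro abs_exp_minus_diff_le)
  also have "\<dots> \<le> \<epsilon>" using *[rule_format, OF k] by blast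
  finally show "\<bar>reach_prob (hypergraph_rate \<beta> N) k - (1 - exp (- reach_series \<beta> ?s))\<bar> \<le> \<epsilon>"
    unfolding reach_prob_def by linarith
qed

text \<open>The limit of \<open>exposed_rate\<close> per vertex.\<close>

definition edge_density :: "(nat \<Rightarrow> real) \<Rightarrow> real \<Rightarrow> real" where
  "edge_density \<beta> t = (\<Sum>j. \<beta> j * t ^ j) + (1 - t) * reach_series \<beta> t"

lemma exposed_rate_limit:
  assumes \<beta>: "\<And>j. \<beta> j \<ge> 0" and t: "0 \<le> z" "z < t1" "t1 \<le> 1"
    and sm: "summable (\<lambda>j. real (Suc j) * \<beta> (Suc j) * t1 ^ j)" and e: "\<epsilon> > 0"
  shows "\<exists>\<eta>>0. \<forall>\<^sub>F N in sequentially. \<forall>k. \<bar>real k - z * real N\<bar> \<le> \<eta> * real N \<longrightarrow>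
    \<bar>exposed_rate (hypergraph_rate \<beta> N) N k - real N * edge_density \<beta> z\<bar> \<le> real N * \<epsilon>"
proof -
  let ?b = "\<lambda>s. \<Sum>j. \<beta> j * s ^ j" and ?g = "reach_series \<beta>"
  have smb: "summable (\<lambda>j. \<beta> j * t1 ^ j)" using summable_gen_series[of \<beta> t1] \<beta> t sm by simp
  have "isCont (edge_density \<beta>) z"
    unfolding edge_density_def reach_series_def
    by (intro continuous_intros isCont_powser[OF sm] isCont_powser[OF smb]) (use t in auto)
  then obtain d where d: "d > 0" "\<And>s. \<bar>s - z\<bar> < d \<Longrightarrow> \<bar>edge_density \<beta> s - edge_density \<beta> z\<bar> < \<epsilon> / 3"
    unfolding continuous_at_eps_delta dist_real_def using e by (metis zero_less_divide_iff zero_less_numeral)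
  define \<eta> where "\<eta> = min (d / 2) ((t1 - z) / 2)"
  have \<eta>: "\<eta> > 0" "\<eta> < d" "z + \<eta> < t1" using d t by (auto simp: \<eta>_def min_def field_simps)
  have t0: "0 \<le> z + \<eta>" using t \<eta> by simp
  have e3: "\<epsilon> / 3 > 0" using e by simp
  obtain n0 where n0: "\<And>n k s. n \<ge> n0 \<Longrightarrow> 0 \<le> s \<Longrightarrow> s \<le> z + \<eta> \<Longrightarrow>
      \<bar>s * real n - real k\<bar> \<le> 1 \<Longrightarrow> \<bar>hyper_sum \<beta> n k - ?b s\<bar> \<le> \<epsilon> / 3"
    using hyper_sum_uniform_limit[where c = \<beta>, OF \<beta> t0 \<eta>(3) t(3) smb e3] by blast
  have "\<forall>\<^sub>F N in sequentially. \<forall>k. \<bar>real k - z * real N\<bar> \<le> \<eta> * real N \<longrightarrow>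
    \<bar>exposed_rate (hypergraph_rate \<beta> N) N k - real N * edge_density \<beta> z\<bar> \<le> real N * \<epsilon>"
    using reach_rate_uniform_limit[where \<beta> = \<beta>, OF \<beta> t0 \<eta>(3) t(3) sm e3]
      eventually_ge_at_top[of "Suc n0"]
  proof (eventually_elim, intro allI impI)
    fix N k
    assume *: "\<forall>k. real k \<le> (z + \<eta>) * real N \<longrightarrow>
      k < N \<and> \<bar>reach_rate (hypergraph_rate \<beta> N) k - ?g (real k / real N)\<bar> \<le> \<epsilon> / 3"
      and N: "Suc n0 \<le> N" and k: "\<bar>real k - z * real N\<bar> \<le> \<eta> * real N"
    let ?s = "real k / real N" and ?R = "reach_rate (hypergraph_rate \<beta> N) k"
    have Npos: "real N > 0" using N by simp
    have kz: "real k \<le> (z + \<eta>) * real N" using k by (simp add: distrib_right)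
    have R: "k < N" "\<bar>?R - ?g ?s\<bar> \<le> \<epsilon> / 3" using *[rule_format, OF kz] by auto
    have s: "0 \<le> ?s" "?s \<le> z + \<eta>" "?s \<le> 1" using kz Npos R(1) by (auto simp: divide_le_eq)
    have H: "\<bar>hyper_sum \<beta> N k - ?b ?s\<bar> \<le> \<epsilon> / 3" using n0[of N ?s k] N s Npos by simp
    have "?s - z = (real k - z * real N) / real N" using Npos by (simp add: field_simps)
    then have "\<bar>?s - z\<bar> \<le> \<eta>" using k Npos by (simp add: divide_le_eq)
    then have D: "\<bar>edge_density \<beta> ?s - edge_density \<beta> z\<bar> < \<epsilon> / 3" using d(2)[of ?s] \<eta> by simp
    define u v w where "u = hyper_sum \<beta> N k - ?b ?s" and "v = (1 - ?s) * (?R - ?g ?s)"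
      and "w = edge_density \<beta> ?s - edge_density \<beta> z"
    have "exposed_rate (hypergraph_rate \<beta> N) N k = real N * (hyper_sum \<beta> N k + (1 - ?s) * ?R)"
      using R(1) Npos by (simp add: exposed_rate_def inner_rate_hypergraph of_nat_diff field_simps)
    then have split: "exposed_rate (hypergraph_rate \<beta> N) N k - real N * edge_density \<beta> z =
        real N * (u + v + w)"
      by (simp add: u_def v_def w_def edge_density_def algebra_simps)
    have "\<bar>v\<bar> \<le> 1 * (\<epsilon> / 3)"
      unfolding v_def abs_mult using s R by (intro mult_mono) auto
    moreover have "\<bar>u\<bar> \<le> \<epsilon> / 3" using H by (simp only: u_def)
    moreover have "\<bar>w\<bar> \<le> \<epsilon> / 3" using D by (simp only: w_def less_imp_le)
    ultimately have "\<bar>u + v + w\<bar> \<le> \<epsilon>" by linarith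
    then show "\<bar>exposed_rate (hypergraph_rate \<beta> N) N k - real N * edge_density \<beta> z\<bar> \<le> real N * \<epsilon>"
      unfolding split using Npos by (simp add: abs_mult)
  qed
  then show ?thesis using \<eta>(1) by blast
qed

section \<open>Limits of the fractions under the product law\<close>

lemma binomial_upper_tail:
  assumes "q \<in> {0..1}" "n > 0" "d \<ge> 0"
  shows "measure_pmf.prob (binomial_pmf n q) {x. real n * (q + d) \<le> real x} \<le> exp (- 2 * d\<^sup>2 * real n)"
proof -
  interpret binomial_distribution n q by unfold_locales fact
  show ?thesis
    using prob_ge[OF assms(2), of "real n * d"] assms by (simp add: power2_eq_square algebra_simps)
qed

lemma binomial_lower_tail:
  assumes "q \<in> {0..1}" "n > 0" "d \<ge> 0"
  shows "measure_pmf.prob (binomial_pmf n q) {x. real x \<le> real n * (q - d)} \<le> exp (- 2 * d\<^sup>2 * real n)"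
proof -
  interpret binomial_distribution n q by unfold_locales fact
  show ?thesis
    using prob_le[OF assms(2), of "real n * d"] assms by (simp add: power2_eq_square algebra_simps)
qed

text \<open>The factor \<open>n + 1\<close> comes from union bounds over the possible numbers of identifiable vertices.\<close>

lemma linear_times_exp_tendsto_0:
  fixes c :: real
  assumes "c > 0"
  shows "(\<lambda>n. (real n + 1) * exp (- c * real n)) \<longlonglongrightarrow> 0"
proof -
  have *: "norm (exp (- c)) < 1" using assms by simp
  have "(\<lambda>n. real n * exp (- c) ^ n + exp (- c) ^ n) \<longlonglongrightarrow> 0 + 0"
    by (intro tendsto_add powser_times_n_limit_0 LIMSEQ_power_zero *)
  moreover have "exp (- c) ^ n = exp (- c * real n)" for n
    by (simp add: exp_of_nat_mult[symmetric] mult.commute)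
  ultimately show ?thesis by (simp add: distrib_right)
qed

context
  fixes \<beta> :: "nat \<Rightarrow> real" and V :: "nat \<Rightarrow> 'v set"
  assumes \<beta>: "\<And>j. \<beta> j \<ge> 0" and z1: "z_star \<beta> < 1" and zeta: "zeta \<beta> = {}"
    and finV: "\<And>N. N \<ge> 1 \<Longrightarrow> finite (V N)" and cardV: "\<And>N. N \<ge> 1 \<Longrightarrow> card (V N) = N"
begin

abbreviation hyp_prob :: "nat \<Rightarrow> (('v set \<Rightarrow> nat) \<Rightarrow> bool) \<Rightarrow> real" where
  "hyp_prob N P \<equiv> measure_pmf.prob (hypergraph_pmf (hypergraph_rate \<beta> N) (V N)) {L. P L}"

lemma hypergraph_rate_nonneg': "hypergraph_rate \<beta> N j \<ge> 0" by (rule hypergraph_rate_nonneg[OF \<beta>])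

text \<open>One binomial estimate suffices: with \<open>t\<close> slightly above \<open>z_star \<beta>\<close> such that
\<open>1 - exp (- reach_series \<beta> t) < t\<close>, and \<open>k\<close> the integer part of \<open>t * N\<close>, the success probability
stays below \<open>k / N\<close>.\<close>

lemma identifiable_fraction_upper:
  assumes e: "\<epsilon> > 0"
  shows "(\<lambda>N. hyp_prob N (\<lambda>L. real (card (identifiable_vertices (V N) L)) > (z_star \<beta> + \<epsilon>) * real N))
    \<longlonglongrightarrow> 0"
proof -
  let ?z = "z_star \<beta>" and ?g = "reach_series \<beta>"
  have z0: "0 \<le> ?z" by (rule z_star_nonneg[where \<beta> = \<beta>, OF \<beta> z1 zeta])
  note approx = z_star_approx[where \<beta> = \<beta>, OF \<beta> z1 zeta]
  obtain t1 where t1: "?z < t1" "t1 < 1" "summable (\<lambda>j. real (Suc j) * \<beta> (Suc j) * t1 ^ j)"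
    using approx[OF zero_less_one] by blast
  have "min \<epsilon> (t1 - ?z) > 0" using e t1 by simp
  from approx[OF this] obtain t where t: "?z < t" "t < ?z + min \<epsilon> (t1 - ?z)" "1 - t < exp (- ?g t)"
    "summable (\<lambda>j. real (Suc j) * \<beta> (Suc j) * t ^ j)" by blast
  then have t': "t < ?z + \<epsilon>" "t < t1" "0 \<le> t" using z0 by linarith+
  define d where "d = (exp (- ?g t) - (1 - t)) / 3"
  have d: "d > 0" using t by (simp add: d_def)
  have t1': "t1 \<le> 1" using t1 by simp
  have bound: "\<forall>\<^sub>F N in sequentially.
    hyp_prob N (\<lambda>L. real (card (identifiable_vertices (V N) L)) > (?z + \<epsilon>) * real N) \<le>
      (real N + 1) * exp (- (2 * d\<^sup>2) * real N)"
    using reach_prob_uniform_limit[where \<beta> = \<beta>, OF \<beta> t'(3,2) t1' t1(3) d]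
      eventually_ge_at_top[of "nat \<lceil>1 / d\<rceil> + 1"]
  proof eventually_elim
    fix N
    assume *: "\<forall>k. real k \<le> t * real N \<longrightarrow> \<bar>reach_prob (hypergraph_rate \<beta> N) k -
        (1 - exp (- ?g (real k / real N)))\<bar> \<le> d"
      and N: "nat \<lceil>1 / d\<rceil> + 1 \<le> N"
    have N1: "N \<ge> 1" using N by simp
    \<comment> \<open>The gap \<open>3 * d\<close> is split: one \<open>d\<close> for the approximation of the rate, one for the deviation of
      the binomial variable, and one for rounding \<open>t * N\<close> down, which costs \<open>1 \<le> d * N\<close>.\<close>
    have "1 / d \<le> real N" using N by linarith
    then have dN: "1 \<le> d * real N" using d by (simp add: field_simps)
    define k where "k = nat \<lfloor>t * real N\<rfloor>"
    have k: "real k \<le> t * real N" "t * real N - 1 \<le> real k"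
      using t'(3) by (auto simp: k_def)
    let ?q = "reach_prob (hypergraph_rate \<beta> N) k"
    have q01: "?q \<in> {0..1}" using reach_prob_bounds hypergraph_rate_nonneg' by blast
    have "?g (real k / real N) \<le> ?g t"
      using k(1) N1 t(4) \<beta> by (intro reach_series_mono) (auto simp: divide_le_eq)
    then have "exp (- ?g t) \<le> exp (- ?g (real k / real N))" by simp
    moreover have "3 * d = exp (- ?g t) - (1 - t)" by (simp add: d_def)
    ultimately have "?q \<le> t - 2 * d" using *[rule_format, OF k(1)] by linarith
    then have "real N * (?q + d) \<le> real N * (t - d)" by (intro mult_left_mono) auto
    also have "\<dots> \<le> real k" using k dN by (simp add: algebra_simps)
    finally have qk: "real N * (?q + d) \<le> real k" .
    have "hyp_prob N (\<lambda>L. real (card (identifiable_vertices (V N) L)) > (?z + \<epsilon>) * real N) \<le>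
        hyp_prob N (\<lambda>L. \<not> card (identifiable_vertices (V N) L) < k)"
    proof (rule measure_pmf.finite_measure_mono)
      have "t * real N \<le> (?z + \<epsilon>) * real N" using t'(1) by (intro mult_right_mono) auto
      with k(1) have "real k \<le> (?z + \<epsilon>) * real N" by (rule order_trans)
      then show "{L. real (card (identifiable_vertices (V N) L)) > (?z + \<epsilon>) * real N} \<subseteq>
          {L. \<not> card (identifiable_vertices (V N) L) < k}" by auto
    qed simp
    also have "\<dots> = 1 - hyp_prob N (\<lambda>L. card (identifiable_vertices (V N) L) < k)"
    proof -
      let ?p = "hypergraph_pmf (hypergraph_rate \<beta> N) (V N)"
      let ?E = "{L. card (identifiable_vertices (V N) L) < k}"
      have "{L. \<not> card (identifiable_vertices (V N) L) < k} = space (measure_pmf ?p) - ?E" by auto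
      then show ?thesis using measure_pmf.prob_compl[of ?E ?p] by simp
    qed
    also have "\<dots> \<le> 1 - measure_pmf.prob (binomial_pmf N ?q) {..<k}"
      using card_identifiable_less_ge[where r = "hypergraph_rate \<beta> N" and k = k, OF finV[OF N1] hypergraph_rate_nonneg']
      by (simp add: cardV[OF N1])
    also have "\<dots> = measure_pmf.prob (binomial_pmf N ?q) (UNIV - {..<k})"
      using measure_pmf.prob_compl[of "{..<k}" "binomial_pmf N ?q"] by simp
    also have "\<dots> \<le> measure_pmf.prob (binomial_pmf N ?q) {x. real N * (?q + d) \<le> real x}"
      using qk by (intro measure_pmf.finite_measure_mono) auto
    also have "\<dots> \<le> exp (- 2 * d\<^sup>2 * real N)"
      using N1 d q01 by (intro binomial_upper_tail) auto
    also have "\<dots> \<le> (real N + 1) * exp (- (2 * d\<^sup>2) * real N)" by simp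
    finally show "hyp_prob N (\<lambda>L. real (card (identifiable_vertices (V N) L)) > (?z + \<epsilon>) * real N) \<le>
      (real N + 1) * exp (- (2 * d\<^sup>2) * real N)" .
  qed
  show ?thesis
    by (rule tendsto_sandwich[OF _ bound tendsto_const linear_times_exp_tendsto_0]) (use d in auto)
qed

text \<open>On \<open>[0, z_star \<beta> - \<epsilon>]\<close> the continuous function \<open>1 - s - exp (- reach_series \<beta> s)\<close> has a positive
minimum, so each value \<open>k\<close> in this range is a large deviation of its own binomial variable, and there
are at most \<open>N + 1\<close> of them.\<close>

lemma identifiable_fraction_lower:
  assumes e: "\<epsilon> > 0"
  shows "(\<lambda>N. hyp_prob N (\<lambda>L. real (card (identifiable_vertices (V N) L)) < (z_star \<beta> - \<epsilon>) * real N))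
    \<longlonglongrightarrow> 0"
proof (cases "z_star \<beta> - \<epsilon> \<le> 0")
  case True
  have "(z_star \<beta> - \<epsilon>) * real N \<le> real n" for N n
    using True by (meson mult_nonpos_nonneg of_nat_0_le_iff order_trans)
  then have "\<not> real n < (z_star \<beta> - \<epsilon>) * real N" for N n by (simp add: not_less)
  then show ?thesis by simp
next
  case False
  let ?z = "z_star \<beta>" and ?g = "reach_series \<beta>"
  define a where "a = ?z - \<epsilon>"
  have a: "0 \<le> a" "a < ?z" using False e by (auto simp: a_def)
  obtain t1 where t1: "?z < t1" "t1 < 1" "summable (\<lambda>j. real (Suc j) * \<beta> (Suc j) * t1 ^ j)"
    using z_star_approx[where \<beta> = \<beta>, OF \<beta> z1 zeta zero_less_one] by blast
  have t1': "a < t1" "t1 \<le> 1" using t1 a by auto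
  define \<phi> where "\<phi> s = 1 - s - exp (- ?g s)" for s
  have "continuous_on {0..a} \<phi>"
    unfolding \<phi>_def by (intro continuous_intros continuous_on_reach_series[OF a(1) t1'(1) t1(3)])
  moreover have "{0..a} \<noteq> {}" using a by simp
  ultimately obtain s0 where s0: "s0 \<in> {0..a}"
    "\<And>s. s \<in> {0..a} \<Longrightarrow> \<phi> s0 \<le> \<phi> s"
    using continuous_attains_inf[OF compact_Icc, of 0 a] by blast
  define d where "d = \<phi> s0 / 2"
  have d: "d > 0"
    using below_z_star[where \<beta> = \<beta>, OF \<beta> z1 zeta, of s0] s0(1) a by (simp add: d_def \<phi>_def)
  have bound: "\<forall>\<^sub>F N in sequentially.
    hyp_prob N (\<lambda>L. real (card (identifiable_vertices (V N) L)) < a * real N) \<le>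
      (real N + 1) * exp (- (2 * d\<^sup>2) * real N)"
    using reach_prob_uniform_limit[where \<beta> = \<beta>, OF \<beta> a(1) t1' t1(3) d] eventually_ge_at_top[of 1]
  proof eventually_elim
    fix N :: nat
    assume *: "\<forall>k. real k \<le> a * real N \<longrightarrow> \<bar>reach_prob (hypergraph_rate \<beta> N) k -
        (1 - exp (- ?g (real k / real N)))\<bar> \<le> d" and N1: "1 \<le> N"
    have each: "hyp_prob N (\<lambda>L. card (identifiable_vertices (V N) L) = k) \<le> exp (- (2 * d\<^sup>2) * real N)"
      if k: "real k \<le> a * real N" for k
    proof -
      let ?q = "reach_prob (hypergraph_rate \<beta> N) k" and ?s = "real k / real N"
      have q01: "?q \<in> {0..1}" using reach_prob_bounds hypergraph_rate_nonneg' by blast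
      have "?s \<in> {0..a}" using k N1 by (auto simp: divide_le_eq)
      from s0(2)[OF this] have "2 * d \<le> \<phi> ?s" by (simp add: d_def)
      then have "2 * d \<le> 1 - ?s - exp (- ?g ?s)" by (simp only: \<phi>_def)
      then have "?s \<le> ?q - d" using *[rule_format, OF k] by linarith
      then have kq: "real k \<le> real N * (?q - d)" using N1 by (simp add: divide_le_eq mult.commute)
      have "hyp_prob N (\<lambda>L. card (identifiable_vertices (V N) L) = k) \<le> pmf (binomial_pmf N ?q) k"
        using card_identifiable_eq_le[where r = "hypergraph_rate \<beta> N" and k = k, OF finV[OF N1] hypergraph_rate_nonneg']
        by (simp add: cardV[OF N1])
      also have "\<dots> = measure_pmf.prob (binomial_pmf N ?q) {k}" by (simp add: measure_pmf_single)
      also have "\<dots> \<le> measure_pmf.prob (binomial_pmf N ?q) {x. real x \<le> real N * (?q - d)}"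
        using kq by (intro measure_pmf.finite_measure_mono) auto
      also have "\<dots> \<le> exp (- 2 * d\<^sup>2 * real N)"
        using N1 d q01 by (intro binomial_lower_tail) auto
      finally show ?thesis by simp
    qed
    let ?K = "{k. k \<le> N \<and> real k \<le> a * real N}"
    have "hyp_prob N (\<lambda>L. real (card (identifiable_vertices (V N) L)) < a * real N) \<le>
        measure_pmf.prob (hypergraph_pmf (hypergraph_rate \<beta> N) (V N))
          (\<Union>k\<in>?K. {L. card (identifiable_vertices (V N) L) = k})"
    proof (rule measure_pmf.finite_measure_mono)
      have "card (identifiable_vertices (V N) L) \<le> N" for L
        using card_mono[OF finV[OF N1] identifiable_subset] cardV[OF N1] by metis
      then show "{L. real (card (identifiable_vertices (V N) L)) < a * real N} \<subseteq>
          (\<Union>k\<in>?K. {L. card (identifiable_vertices (V N) L) = k})" by auto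
    qed simp
    also have "\<dots> \<le> (\<Sum>k\<in>?K. hyp_prob N (\<lambda>L. card (identifiable_vertices (V N) L) = k))"
      by (rule measure_UNION_le) auto
    also have "\<dots> \<le> (\<Sum>k\<in>?K. exp (- (2 * d\<^sup>2) * real N))"
      by (intro sum_mono each) auto
    also have "\<dots> \<le> (real N + 1) * exp (- (2 * d\<^sup>2) * real N)"
    proof -
      have "card ?K \<le> card {..N}" by (intro card_mono) auto
      then have "real (card ?K) \<le> real N + 1" by simp
      then show ?thesis by (simp add: mult_right_mono)
    qed
    finally show "hyp_prob N (\<lambda>L. real (card (identifiable_vertices (V N) L)) < a * real N) \<le>
      (real N + 1) * exp (- (2 * d\<^sup>2) * real N)" .
  qed
  show ?thesis
    unfolding a_def[symmetric]
    by (rule tendsto_sandwich[OF _ bound tendsto_const linear_times_exp_tendsto_0]) (use d in auto)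
qed

lemma identifiable_fraction_limit:
  assumes e: "\<epsilon> > 0"
  shows "(\<lambda>N. hyp_prob N (\<lambda>L. \<bar>real (card (identifiable_vertices (V N) L)) - z_star \<beta> * real N\<bar> > \<epsilon> * real N))
    \<longlonglongrightarrow> 0"
proof (rule tendsto_sandwich[OF _ _ tendsto_const])
  let ?X = "\<lambda>N L. real (card (identifiable_vertices (V N) L))"
  show "(\<lambda>N. hyp_prob N (\<lambda>L. ?X N L > (z_star \<beta> + \<epsilon>) * real N) +
      hyp_prob N (\<lambda>L. ?X N L < (z_star \<beta> - \<epsilon>) * real N)) \<longlonglongrightarrow> 0"
    using tendsto_add[OF identifiable_fraction_upper[OF e] identifiable_fraction_lower[OF e]] by simp
  have "hyp_prob N (\<lambda>L. \<bar>?X N L - z_star \<beta> * real N\<bar> > \<epsilon> * real N) \<le>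
      measure_pmf.prob (hypergraph_pmf (hypergraph_rate \<beta> N) (V N))
        ({L. ?X N L > (z_star \<beta> + \<epsilon>) * real N} \<union> {L. ?X N L < (z_star \<beta> - \<epsilon>) * real N})" for N
    by (rule measure_pmf.finite_measure_mono) (auto simp: algebra_simps abs_if split: if_splits)
  also have "\<dots> N \<le> hyp_prob N (\<lambda>L. ?X N L > (z_star \<beta> + \<epsilon>) * real N) +
      hyp_prob N (\<lambda>L. ?X N L < (z_star \<beta> - \<epsilon>) * real N)" for N
    by (rule measure_Un_le) auto
  finally show "\<forall>\<^sub>F N in sequentially. hyp_prob N (\<lambda>L. \<bar>?X N L - z_star \<beta> * real N\<bar> > \<epsilon> * real N) \<le>
      hyp_prob N (\<lambda>L. ?X N L > (z_star \<beta> + \<epsilon>) * real N) +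
      hyp_prob N (\<lambda>L. ?X N L < (z_star \<beta> - \<epsilon>) * real N)" by simp
qed auto

text \<open>The number of identifiable vertices is first confined to a window around \<open>z_star \<beta> * N\<close> in which
\<open>exposed_rate\<close> is close to its limit; in the window, the bound of \<open>edge_count_concentration\<close> is
summed over the possible values.\<close>

lemma identifiable_edges_limit:
  assumes e: "\<epsilon> > 0"
  shows "(\<lambda>N. hyp_prob N (\<lambda>L. \<bar>real (\<Sum>A\<in>Pow (identifiable_vertices (V N) L). L A) -
      real N * edge_density \<beta> (z_star \<beta>)\<bar> > real N * \<epsilon>)) \<longlonglongrightarrow> 0"
proof -
  let ?z = "z_star \<beta>" and ?B = "edge_density \<beta> (z_star \<beta>)"
  let ?X = "\<lambda>N L. card (identifiable_vertices (V N) L)"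
  let ?Y = "\<lambda>N L. real (\<Sum>A\<in>Pow (identifiable_vertices (V N) L). L A)"
  have z0: "0 \<le> ?z" by (rule z_star_nonneg[where \<beta> = \<beta>, OF \<beta> z1 zeta])
  obtain t1 where t1: "?z < t1" "t1 < 1" "summable (\<lambda>j. real (Suc j) * \<beta> (Suc j) * t1 ^ j)"
    using z_star_approx[where \<beta> = \<beta>, OF \<beta> z1 zeta zero_less_one] by blast
  have smz: "summable (\<lambda>j. real (Suc j) * \<beta> (Suc j) * ?z ^ j)"
    using summable_reach_series[of \<beta> ?z t1] \<beta> z0 t1 by simp
  have B: "?B \<ge> 0"
    unfolding edge_density_def
    using z1 z0 \<beta> smz summable_gen_series[of \<beta> ?z] reach_series_nonneg[of \<beta> ?z]
    by (intro add_nonneg_nonneg mult_nonneg_nonneg suminf_nonneg) auto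
  have "\<epsilon> / 2 > 0" "t1 \<le> 1" using e t1 by auto
  then obtain \<eta> where \<eta>: "\<eta> > 0" and ev: "\<forall>\<^sub>F N in sequentially. \<forall>k.
      \<bar>real k - ?z * real N\<bar> \<le> \<eta> * real N \<longrightarrow>
      \<bar>exposed_rate (hypergraph_rate \<beta> N) N k - real N * ?B\<bar> \<le> real N * (\<epsilon> / 2)"
    using exposed_rate_limit[where \<beta> = \<beta>, OF \<beta> z0 t1(1) _ t1(3), of "\<epsilon> / 2"] by blast
  define c where "c = min 1 (\<epsilon> / (4 * (?B + \<epsilon>))) * \<epsilon> / 4"
  have c: "c > 0" using B e by (simp add: c_def)
  have bound: "\<forall>\<^sub>F N in sequentially. hyp_prob N (\<lambda>L. \<bar>?Y N L - real N * ?B\<bar> > real N * \<epsilon>) \<le>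
      hyp_prob N (\<lambda>L. \<bar>real (?X N L) - ?z * real N\<bar> > \<eta> * real N) +
      2 * ((real N + 1) * exp (- c * real N))"
    using ev eventually_ge_at_top[of 1]
  proof eventually_elim
    fix N :: nat
    assume near: "\<forall>k. \<bar>real k - ?z * real N\<bar> \<le> \<eta> * real N \<longrightarrow>
      \<bar>exposed_rate (hypergraph_rate \<beta> N) N k - real N * ?B\<bar> \<le> real N * (\<epsilon> / 2)" and N1: "1 \<le> N"
    let ?K = "{k. k \<le> N \<and> \<bar>real k - ?z * real N\<bar> \<le> \<eta> * real N}"
    let ?far = "{L. \<bar>real (?X N L) - ?z * real N\<bar> > \<eta> * real N}"
    let ?bad = "\<lambda>k. {L. ?X N L = k \<and> \<bar>?Y N L - real N * ?B\<bar> > real N * \<epsilon>}"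
    let ?P = "measure_pmf.prob (hypergraph_pmf (hypergraph_rate \<beta> N) (V N))"
    have each: "?P (?bad k) \<le> 2 * exp (- c * real N)" if "k \<in> ?K" for k
      using edge_count_concentration[where r = "hypergraph_rate \<beta> N" and k = k,
          OF finV[OF N1] hypergraph_rate_nonneg' B e] near that
      by (simp add: cardV[OF N1] c_def)
    have "hyp_prob N (\<lambda>L. \<bar>?Y N L - real N * ?B\<bar> > real N * \<epsilon>) \<le> ?P (?far \<union> (\<Union>k\<in>?K. ?bad k))"
    proof (rule measure_pmf.finite_measure_mono)
      have "?X N L \<le> N" for L
        using card_mono[OF finV[OF N1] identifiable_subset] cardV[OF N1] by metis
      then show "{L. \<bar>?Y N L - real N * ?B\<bar> > real N * \<epsilon>} \<subseteq> ?far \<union> (\<Union>k\<in>?K. ?bad k)"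
        by (auto simp: not_less)
    qed simp
    also have "\<dots> \<le> ?P ?far + ?P (\<Union>k\<in>?K. ?bad k)"
      by (rule measure_Un_le) auto
    also have "?P (\<Union>k\<in>?K. ?bad k) \<le> (\<Sum>k\<in>?K. ?P (?bad k))"
      by (rule measure_UNION_le) auto
    also have "\<dots> \<le> (\<Sum>k\<in>?K. 2 * exp (- c * real N))" by (intro sum_mono each)
    also have "\<dots> \<le> 2 * ((real N + 1) * exp (- c * real N))"
    proof -
      have "card ?K \<le> card {..N}" by (intro card_mono) auto
      then have "real (card ?K) \<le> real N + 1" by simp
      then show ?thesis by (simp add: mult_right_mono)
    qed
    finally show "hyp_prob N (\<lambda>L. \<bar>?Y N L - real N * ?B\<bar> > real N * \<epsilon>) \<le>
      ?P ?far + 2 * ((real N + 1) * exp (- c * real N))" by simp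
  qed
  have lim: "(\<lambda>N. hyp_prob N (\<lambda>L. \<bar>real (?X N L) - ?z * real N\<bar> > \<eta> * real N) +
      2 * ((real N + 1) * exp (- c * real N))) \<longlonglongrightarrow> 0"
    using tendsto_add[OF identifiable_fraction_limit[OF \<eta>]
        tendsto_mult[OF tendsto_const[of 2] linear_times_exp_tendsto_0[OF c]]] by simp
  show ?thesis by (rule tendsto_sandwich[OF _ bound tendsto_const lim]) simp
qed

end

section \<open>Convergence in probability\<close>

lemma converges_in_prob_poisson_hypergraph:
  fixes \<Lambda> :: "nat \<Rightarrow> 'a \<Rightarrow> 'v set \<Rightarrow> nat"
  assumes \<beta>: "\<And>j. \<beta> j \<ge> 0" and cardV: "\<And>N. N \<ge> 1 \<Longrightarrow> card (V N) = N"
    and P: "\<And>N. N \<ge> 1 \<Longrightarrow> poisson_hypergraph (M N) (V N) \<beta> (\<Lambda> N)"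
    and cong: "\<And>N L L'. (\<And>A. A \<subseteq> V N \<Longrightarrow> L A = L' A) \<Longrightarrow> f N L = f N L'"
    and lim: "\<And>\<epsilon>. \<epsilon> > 0 \<Longrightarrow> (\<lambda>N. measure_pmf.prob (hypergraph_pmf (hypergraph_rate \<beta> N) (V N))
      {L. \<bar>f N L - c\<bar> > \<epsilon>}) \<longlonglongrightarrow> 0"
  shows "converges_in_prob M (\<lambda>N \<omega>. f N (\<Lambda> N \<omega>)) c"
  unfolding converges_in_prob_def
proof (intro conjI allI impI)
  show "\<forall>\<^sub>F N in sequentially. (\<lambda>\<omega>. f N (\<Lambda> N \<omega>)) \<in> borel_measurable (M N)"
    using eventually_ge_at_top[of 1]
  proof eventually_elim
    fix N :: nat assume N: "1 \<le> N"
    have "{\<omega> \<in> space (M N). f N (\<Lambda> N \<omega>) < a} \<in> sets (M N)" for a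
      by (rule poisson_hypergraph_law(1)[OF P[OF N] \<beta>]) (metis cong)
    then show "(\<lambda>\<omega>. f N (\<Lambda> N \<omega>)) \<in> borel_measurable (M N)"
      by (rule borel_measurableI_less)
  qed
  fix \<epsilon> :: real assume e: "\<epsilon> > 0"
  have "\<forall>\<^sub>F N in sequentially. measure_pmf.prob (hypergraph_pmf (hypergraph_rate \<beta> N) (V N))
      {L. \<bar>f N L - c\<bar> > \<epsilon>} = measure (M N) {\<omega> \<in> space (M N). \<bar>f N (\<Lambda> N \<omega>) - c\<bar> > \<epsilon>}"
    using eventually_ge_at_top[of 1]
  proof eventually_elim
    fix N :: nat assume N: "1 \<le> N"
    have "measure (M N) {\<omega> \<in> space (M N). \<bar>f N (\<Lambda> N \<omega>) - c\<bar> > \<epsilon>} =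
        measure_pmf.prob (hypergraph_pmf (hypergraph_rate \<beta> (card (V N))) (V N))
          {L. \<bar>f N L - c\<bar> > \<epsilon>}"
      by (rule poisson_hypergraph_law(2)[OF P[OF N] \<beta>]) (metis cong)
    then show "measure_pmf.prob (hypergraph_pmf (hypergraph_rate \<beta> N) (V N))
      {L. \<bar>f N L - c\<bar> > \<epsilon>} = measure (M N) {\<omega> \<in> space (M N). \<bar>f N (\<Lambda> N \<omega>) - c\<bar> > \<epsilon>}"
      by (simp add: cardV[OF N])
  qed
  then show "(\<lambda>N. measure (M N) {\<omega> \<in> space (M N). \<bar>f N (\<Lambda> N \<omega>) - c\<bar> > \<epsilon>}) \<longlonglongrightarrow> 0"
    using lim[OF e] by (rule Lim_transform_eventually[rotated])
qed

theorem theorem2p1: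
  fixes \<beta> :: "nat \<Rightarrow> real"
    and V :: "nat \<Rightarrow> 'v set"
    and M :: "nat \<Rightarrow> 'a measure"
    and \<Lambda> :: "nat \<Rightarrow> 'a \<Rightarrow> 'v set \<Rightarrow> nat"
  assumes \<beta>_nonneg: "\<And>j. \<beta> j \<ge> 0"
    and z_star_less_1: "z_star \<beta> < 1"
    and zeta_empty: "zeta \<beta> = {}"
    and card_V: "\<And>N. N \<ge> 1 \<Longrightarrow> card (V N) = N"
    and poisson: "\<And>N. N \<ge> 1 \<Longrightarrow> poisson_hypergraph (M N) (V N) \<beta> (\<Lambda> N)"
  shows "converges_in_prob M
           (\<lambda>N \<omega>. real (card (identifiable_vertices (V N) (\<Lambda> N \<omega>))) / real N)
           (z_star \<beta>) \<and>
         converges_in_prob M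
           (\<lambda>N \<omega>. real (num_hyperedges (V N) (identifiable_hypergraph (V N) (\<Lambda> N \<omega>))) / real N)
           (real_of_ereal (gen_series \<beta> (z_star \<beta>)) - (1 - z_star \<beta>) * ln (1 - z_star \<beta>))"
proof -
  let ?z = "z_star \<beta>"
  have finV: "finite (V N)" if "N \<ge> 1" for N using poisson[OF that] by (simp add: poisson_hypergraph_def)
  have scale: "\<bar>x / real N - c\<bar> > \<epsilon> \<longleftrightarrow> \<bar>x - real N * c\<bar> > real N * \<epsilon>" if "N \<ge> 1" for x c \<epsilon> N
  proof -
    have "x / real N - c = (x - real N * c) / real N" using that by (simp add: field_simps)
    then have "\<bar>x / real N - c\<bar> = \<bar>x - real N * c\<bar> / real N" by (simp add: abs_divide)
    then show ?thesis using that by (simp add: less_divide_eq mult.commute)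
  qed
  have z0: "0 \<le> ?z" by (rule z_star_nonneg[where \<beta> = \<beta>, OF \<beta>_nonneg z_star_less_1 zeta_empty])
  obtain t1 where t1: "?z < t1" "t1 < 1" "summable (\<lambda>j. real (Suc j) * \<beta> (Suc j) * t1 ^ j)"
    using z_star_approx[where \<beta> = \<beta>, OF \<beta>_nonneg z_star_less_1 zeta_empty zero_less_one] by blast
  have "summable (\<lambda>j. real (Suc j) * \<beta> (Suc j) * ?z ^ j)"
    using summable_reach_series[of \<beta> ?z t1] \<beta>_nonneg z0 t1 by simp
  then have "summable (\<lambda>j. \<beta> j * ?z ^ j)"
    using summable_gen_series[of \<beta> ?z] \<beta>_nonneg z0 z_star_less_1 by simp
  then have "real_of_ereal (gen_series \<beta> ?z) = (\<Sum>j. \<beta> j * ?z ^ j)"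
    by (simp add: gen_series_def suminf_ereal')
  moreover have "ln (1 - ?z) = - reach_series \<beta> ?z"
    using at_z_star[where \<beta> = \<beta>, OF \<beta>_nonneg z_star_less_1 zeta_empty] by (metis ln_exp)
  ultimately have B: "real_of_ereal (gen_series \<beta> ?z) - (1 - ?z) * ln (1 - ?z) = edge_density \<beta> ?z"
    by (simp add: edge_density_def)
  have "converges_in_prob M (\<lambda>N \<omega>. real (card (identifiable_vertices (V N) (\<Lambda> N \<omega>))) / real N) ?z"
  proof (rule converges_in_prob_poisson_hypergraph[where \<beta> = \<beta> and V = V, OF \<beta>_nonneg card_V poisson])
    fix \<epsilon> :: real assume "\<epsilon> > 0"
    note lim = identifiable_fraction_limit[where \<beta> = \<beta> and V = V,
        OF \<beta>_nonneg z_star_less_1 zeta_empty finV card_V this]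
    show "(\<lambda>N. measure_pmf.prob (hypergraph_pmf (hypergraph_rate \<beta> N) (V N))
        {L. \<bar>real (card (identifiable_vertices (V N) L)) / real N - ?z\<bar> > \<epsilon>}) \<longlonglongrightarrow> 0"
    proof (rule Lim_transform_eventually[OF lim])
      show "\<forall>\<^sub>F N in sequentially. measure_pmf.prob (hypergraph_pmf (hypergraph_rate \<beta> N) (V N))
          {L. \<bar>real (card (identifiable_vertices (V N) L)) - ?z * real N\<bar> > \<epsilon> * real N} =
        measure_pmf.prob (hypergraph_pmf (hypergraph_rate \<beta> N) (V N))
          {L. \<bar>real (card (identifiable_vertices (V N) L)) / real N - ?z\<bar> > \<epsilon>}"
        using eventually_ge_at_top[of 1] by eventually_elim (simp add: scale mult.commute)
    qed
  next
    fix N and L L' :: "'v set \<Rightarrow> nat"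
    assume "\<And>A. A \<subseteq> V N \<Longrightarrow> L A = L' A"
    then have "identifiable_vertices (V N) L = identifiable_vertices (V N) L'" by (rule identifiable_cong)
    then show "real (card (identifiable_vertices (V N) L)) / real N =
        real (card (identifiable_vertices (V N) L')) / real N" by simp
  qed
  moreover have "converges_in_prob M
      (\<lambda>N \<omega>. real (num_hyperedges (V N) (identifiable_hypergraph (V N) (\<Lambda> N \<omega>))) / real N)
      (edge_density \<beta> ?z)"
  proof (rule converges_in_prob_poisson_hypergraph[where \<beta> = \<beta> and V = V, OF \<beta>_nonneg card_V poisson])
    fix N and L L' :: "'v set \<Rightarrow> nat"
    assume eq: "\<And>A. A \<subseteq> V N \<Longrightarrow> L A = L' A"
    then have "identifiable_vertices (V N) L = identifiable_vertices (V N) L'" by (rule identifiable_cong)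
    then have "num_hyperedges (V N) (identifiable_hypergraph (V N) L) =
        num_hyperedges (V N) (identifiable_hypergraph (V N) L')"
      unfolding num_hyperedges_def identifiable_hypergraph_def using eq by (intro sum.cong) auto
    then show "real (num_hyperedges (V N) (identifiable_hypergraph (V N) L)) / real N =
        real (num_hyperedges (V N) (identifiable_hypergraph (V N) L')) / real N" by simp
  next
    fix \<epsilon> :: real assume "\<epsilon> > 0"
    note lim = identifiable_edges_limit[where \<beta> = \<beta> and V = V,
        OF \<beta>_nonneg z_star_less_1 zeta_empty finV card_V this]
    show "(\<lambda>N. measure_pmf.prob (hypergraph_pmf (hypergraph_rate \<beta> N) (V N))
        {L. \<bar>real (num_hyperedges (V N) (identifiable_hypergraph (V N) L)) / real N -
          edge_density \<beta> ?z\<bar> > \<epsilon>}) \<longlonglongrightarrow> 0"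
    proof (rule Lim_transform_eventually[OF lim])
      show "\<forall>\<^sub>F N in sequentially. measure_pmf.prob (hypergraph_pmf (hypergraph_rate \<beta> N) (V N))
          {L. \<bar>real (\<Sum>A\<in>Pow (identifiable_vertices (V N) L). L A) -
            real N * edge_density \<beta> ?z\<bar> > real N * \<epsilon>} =
        measure_pmf.prob (hypergraph_pmf (hypergraph_rate \<beta> N) (V N))
          {L. \<bar>real (num_hyperedges (V N) (identifiable_hypergraph (V N) L)) / real N -
            edge_density \<beta> ?z\<bar> > \<epsilon>}"
        using eventually_ge_at_top[of 1]
        by eventually_elim (simp add: scale num_identifiable_hyperedges finV)
    qed
  qed
  ultimately show ?thesis by (simp add: B)
qed

end
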